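(* Let $R$ be a non-commutative prime ring of characteristic not two with involution $*$, with center $Z(R)$ and extended centroid $C$. If $R$ admits a centrally-extended Jordan epimorphism $G: R \to R$ such that $[G(x), x^*] \in Z(R)$ for all $x \in R$, then either $R$ is an order in a central simple algebra of dimension at most $4$ over its center, or there exists $\lambda \in C$ such that $G(x) = \lambda^* x^*$ for all $x \in R$.
   Context: Rings are associative (a unit is not assumed), $Z(R)$ denotes the center of $R$, $[x,y] = xy - yx$ and $x \circ y = xy + yx$. An involution $*$ on $R$ is an additive map $x \mapsto x^*$ with $(xy)^* = y^*x^*$ and $(x^* )^* = x$ for all $x,y \in R$. The extended centroid $C$ of $R$ is the center of the maximal right ring of quotients $Q_{mr}(R)$ of $R$, which contains $R$; products of elements of $C$ and $R$ are taken in $Q_{mr}(R)$. The involution of the prime ring $R$ extends uniquely to an involution, still denoted $*$, of the central closure $RC + C \subseteq Q_{mr}(R)$; it maps $C$ to $C$ and satisfies $(\lambda x)^* = \lambda^* x^*$ for $\lambda \in C$, $x \in R$. A map $G: R \to R$ (not assumed additive) is a centrally-extended Jordan endomorphism (CE-Jordan endomorphism) if $G(x+y) - G(x) - G(y) \in Z(R)$ and $G(x \circ y) - G(x) \circ G(y) \in Z(R)$ for all $x, y \in R$. A centrally-extended Jordan epimorphism is a surjective CE-Jordan endomorphism. A ring $R$ is an order in a unital ring $A$ if $R$ is a subring of $A$, every regular (non-zero-divisor) element of $R$ is invertible in $A$, and every element of $A$ can be written both as $rs^{-1}$ and as $t^{-1}u$ with $r,s,t,u \in R$ and $s,t$ regular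 in $R$. *)

theory Defs
  imports "HOL-Algebra.Embedded_Algebras"
begin

section \<open>Prime rings, involutions, centrally-extended maps\<close>

text \<open>The type class \<^class>\<open>ring\<close> does not require a unit.\<close>

class prime_ring = ring +
  assumes nonzero: "\<exists>x. x \<noteq> 0"
    and prime: "(\<And>r. a * r * b = 0) \<Longrightarrow> a = 0 \<or> b = 0"

definition ring_center :: "'a::ring set" where
  "ring_center = {z. \<forall>x. z * x = x * z}"

definition commutator :: "'a::ring \<Rightarrow> 'a \<Rightarrow> 'a" where
  "commutator x y = x * y - y * x"

definition jordan_prod :: "'a::ring \<Rightarrow> 'a \<Rightarrow> 'a" where
  "jordan_prod x y = x * y + y * x"

text \<open>The characteristic of a ring that need not have a unit; the sum is the multiple \<open>n x\<close>.\<close>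

definition rng_char :: "'a::ring itself \<Rightarrow> nat" where
  "rng_char _ =
     (if \<exists>n::nat. n > 0 \<and> (\<forall>x::'a. (\<Sum>i<n. x) = 0)
      then LEAST n. n > 0 \<and> (\<forall>x::'a. (\<Sum>i<n. x) = 0) else 0)"

text \<open>\<open>S\<close> is the carrier of a subring; outside \<open>S\<close> the map is unconstrained.\<close>

definition involution_on :: "'a::ring set \<Rightarrow> ('a \<Rightarrow> 'a) \<Rightarrow> bool" where
  "involution_on S f \<longleftrightarrow>
     (\<forall>x\<in>S. f x \<in> S) \<and>
     (\<forall>x\<in>S. \<forall>y\<in>S. f (x + y) = f x + f y) \<and>
     (\<forall>x\<in>S. \<forall>y\<in>S. f (x * y) = f y * f x) \<and>
     (\<forall>x\<in>S. f (f x) = x)"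

abbreviation involution :: "('a::ring \<Rightarrow> 'a) \<Rightarrow> bool" where
  "involution f \<equiv> involution_on UNIV f"

definition ce_jordan_endomorphism :: "('a::ring \<Rightarrow> 'a) \<Rightarrow> bool" where
  "ce_jordan_endomorphism G \<longleftrightarrow>
     (\<forall>x y. G (x + y) - G x - G y \<in> ring_center) \<and>
     (\<forall>x y. G (jordan_prod x y) - jordan_prod (G x) (G y) \<in> ring_center)"

definition ce_jordan_epimorphism :: "('a::ring \<Rightarrow> 'a) \<Rightarrow> bool" where
  "ce_jordan_epimorphism G \<longleftrightarrow> ce_jordan_endomorphism G \<and> surj G"


section \<open>The maximal right ring of quotients\<close>

definition right_ideal :: "'a::ring set \<Rightarrow> bool" where
  "right_ideal J \<longleftrightarrow> 0 \<in> J \<and> (\<forall>x\<in>J. \<forall>y\<in>J. x - y \<in> J) \<and> (\<forall>x\<in>J. \<forall>r. x * r \<in> J)"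

definition dense_right_ideal :: "'a::ring set \<Rightarrow> bool" where
  "dense_right_ideal J \<longleftrightarrow>
     right_ideal J \<and> (\<forall>x y. x \<noteq> 0 \<longrightarrow> (\<exists>r. x * r \<noteq> 0 \<and> y * r \<in> J))"

definition right_hom_on :: "'a::ring set \<Rightarrow> ('a \<Rightarrow> 'a) \<Rightarrow> bool" where
  "right_hom_on J f \<longleftrightarrow>
     (\<forall>x\<in>J. \<forall>y\<in>J. f (x + y) = f x + f y) \<and> (\<forall>x\<in>J. \<forall>r. f (x * r) = f x * r)"

text \<open>A pair \<open>(J, f)\<close> stands for a homomorphism \<open>f : J \<rightarrow> R\<close> of right modules on a dense
  right ideal; the values of \<open>f\<close> outside \<open>J\<close> are irrelevant.\<close>

definition dense_hom :: "'a::ring set \<times> ('a \<Rightarrow> 'a) \<Rightarrow> bool" where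
  "dense_hom p \<longleftrightarrow> dense_right_ideal (fst p) \<and> right_hom_on (fst p) (snd p)"

definition qmr_rel :: "'a::ring set \<times> ('a \<Rightarrow> 'a) \<Rightarrow> 'a set \<times> ('a \<Rightarrow> 'a) \<Rightarrow> bool" where
  "qmr_rel p q \<longleftrightarrow> dense_hom p \<and> dense_hom q \<and>
     (\<exists>L. dense_right_ideal L \<and> L \<subseteq> fst p \<inter> fst q \<and> (\<forall>x\<in>L. snd p x = snd q x))"

lemma right_ideal_closed:
  assumes "right_ideal J"
  shows "0 \<in> J" "x \<in> J \<Longrightarrow> y \<in> J \<Longrightarrow> x - y \<in> J" "x \<in> J \<Longrightarrow> - x \<in> J"
    "x \<in> J \<Longrightarrow> y \<in> J \<Longrightarrow> x + y \<in> J" "x \<in> J \<Longrightarrow> x * r \<in> J"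
proof -
  show z: "0 \<in> J" and d: "x \<in> J \<Longrightarrow> y \<in> J \<Longrightarrow> x - y \<in> J" and "x \<in> J \<Longrightarrow> x * r \<in> J" for x y r
    using assms by (auto simp: right_ideal_def)
  show n: "x \<in> J \<Longrightarrow> - x \<in> J" for x
    using d[OF z, of x] by simp
  show "x \<in> J \<Longrightarrow> y \<in> J \<Longrightarrow> x + y \<in> J"
    using d[of x "- y"] n[of y] by simp
qed

lemma dense_right_ideal_ideal: "dense_right_ideal J \<Longrightarrow> right_ideal J"
  by (simp add: dense_right_ideal_def)

lemmas dense_closed = right_ideal_closed[OF dense_right_ideal_ideal]

lemma dense_right_ideal_ex:
  assumes "dense_right_ideal J" "x \<noteq> 0"
  shows "\<exists>r. x * r \<noteq> 0 \<and> y * r \<in> J"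
  using assms unfolding dense_right_ideal_def by blast

lemma dense_UNIV: "dense_right_ideal (UNIV :: 'a::prime_ring set)"
proof -
  have "\<exists>r. x * r \<noteq> 0" if "x \<noteq> 0" for x :: 'a
    using prime[of x x] that by (metis mult_zero_left)
  then show ?thesis
    by (auto simp: dense_right_ideal_def right_ideal_def)
qed

lemma dense_Int:
  assumes "dense_right_ideal J" "dense_right_ideal K"
  shows "dense_right_ideal (J \<inter> K)"
proof -
  have "\<exists>r. x * r \<noteq> 0 \<and> y * r \<in> J \<inter> K" if x0: "x \<noteq> 0" for x y
  proof -
    obtain r where r: "x * r \<noteq> 0" "y * r \<in> J"
      using dense_right_ideal_ex[OF assms(1) x0] by blast
    obtain s where s: "x * r * s \<noteq> 0" "y * r * s \<in> K"
      using dense_right_ideal_ex[OF assms(2) r(1)] by blast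
    have "y * r * s \<in> J" using r(2) dense_closed(5)[OF assms(1)] by blast
    then show ?thesis using s by (metis IntI mult.assoc)
  qed
  moreover have "right_ideal (J \<inter> K)"
    using assms by (auto simp: right_ideal_def dense_right_ideal_def)
  ultimately show ?thesis by (simp add: dense_right_ideal_def)
qed

lemma right_hom_on_diff:
  assumes "right_ideal J" "right_hom_on J f" "x \<in> J" "y \<in> J"
  shows "f (x - y) = f x - f y"
proof -
  have "f ((x - y) + y) = f (x - y) + f y"
    using assms right_ideal_closed(2)[OF assms(1)] unfolding right_hom_on_def by blast
  then show ?thesis by (simp add: algebra_simps)
qed

lemma right_hom_on_zero:
  assumes "right_ideal J" "right_hom_on J f"
  shows "f 0 = 0"
  using right_hom_on_diff[OF assms] right_ideal_closed(1)[OF assms(1)]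
  by (metis diff_self)

lemma dense_preimage:
  assumes "dense_right_ideal J" "dense_right_ideal K" "right_hom_on K g"
  shows "dense_right_ideal {x \<in> K. g x \<in> J}"
proof -
  have "\<exists>r. x * r \<noteq> 0 \<and> y * r \<in> {x \<in> K. g x \<in> J}" if x0: "x \<noteq> 0" for x y
  proof -
    obtain r where r: "x * r \<noteq> 0" "y * r \<in> K"
      using dense_right_ideal_ex[OF assms(2) x0] by blast
    obtain s where s: "x * r * s \<noteq> 0" "g (y * r) * s \<in> J"
      using dense_right_ideal_ex[OF assms(1) r(1)] by blast
    have "y * r * s \<in> K" "g (y * r * s) = g (y * r) * s"
      using r(2) dense_closed(5)[OF assms(2)] assms(3) by (auto simp: right_hom_on_def)
    then show ?thesis using s by (intro exI[of _ "r * s"]) (simp add: mult.assoc)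
  qed
  moreover have "right_ideal {x \<in> K. g x \<in> J}"
    using right_hom_on_zero[OF _ assms(3)] right_hom_on_diff[OF _ assms(3)]
      dense_closed[OF assms(1)] dense_closed[OF assms(2)] assms
    by (auto simp: right_ideal_def dense_right_ideal_def right_hom_on_def)
  ultimately show ?thesis by (simp add: dense_right_ideal_def)
qed

lemma dense_annihilator:
  fixes c :: "'a::prime_ring"
  assumes "dense_right_ideal J" "\<And>x. x \<in> J \<Longrightarrow> c * x = 0"
  shows "c = 0"
proof (rule ccontr)
  assume "c \<noteq> 0"
  then obtain s where "c * s \<noteq> 0" using dense_right_ideal_ex[OF dense_UNIV] by metis
  then obtain r where "c * s * r \<noteq> 0" "s * r \<in> J" using dense_right_ideal_ex[OF assms(1)] by metis
  then show False using assms(2) by (simp add: mult.assoc)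
qed

lemma qmr_rel_refl: "dense_hom p \<Longrightarrow> qmr_rel p p"
  unfolding qmr_rel_def dense_hom_def by blast

quotient_type (overloaded) 'a qmr = "'a::prime_ring set \<times> ('a \<Rightarrow> 'a)" / partial: qmr_rel
proof (rule part_equivpI)
  have "dense_hom (UNIV :: 'a set, id)"
    by (simp add: dense_hom_def dense_UNIV right_hom_on_def)
  then show "\<exists>p :: 'a set \<times> ('a \<Rightarrow> 'a). qmr_rel p p" using qmr_rel_refl by blast
  show "symp (qmr_rel :: 'a set \<times> ('a \<Rightarrow> 'a) \<Rightarrow> _)"
    unfolding qmr_rel_def by (auto intro!: sympI)
  show "transp (qmr_rel :: 'a set \<times> ('a \<Rightarrow> 'a) \<Rightarrow> _)"
  proof (rule transpI)
    fix p q s :: "'a set \<times> ('a \<Rightarrow> 'a)"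
    assume "qmr_rel p q" "qmr_rel q s"
    then obtain L M where "dense_hom p" "dense_hom s" "dense_right_ideal L" "dense_right_ideal M"
      "L \<subseteq> fst p \<inter> fst q" "\<forall>x\<in>L. snd p x = snd q x" "M \<subseteq> fst q \<inter> fst s" "\<forall>x\<in>M. snd q x = snd s x"
      unfolding qmr_rel_def by blast
    then show "qmr_rel p s"
      unfolding qmr_rel_def by (intro conjI exI[of _ "L \<inter> M"]) (auto intro: dense_Int)
  qed
qed

lemma qmr_relI:
  assumes "dense_hom p" "dense_hom q" "dense_right_ideal L"
    "\<And>x. x \<in> L \<Longrightarrow> x \<in> fst p \<and> x \<in> fst q \<and> snd p x = snd q x"
  shows "qmr_rel p q"
  using assms unfolding qmr_rel_def by blast

lemma qmr_relI_Int:
  assumes "dense_hom p" "dense_hom q"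
    "\<And>x. x \<in> fst p \<Longrightarrow> x \<in> fst q \<Longrightarrow> snd p x = snd q x"
  shows "qmr_rel p q"
  by (rule qmr_relI[where L = "fst p \<inter> fst q"])
    (use assms in \<open>auto simp: dense_hom_def intro: dense_Int\<close>)

lemma qmr_rel_dense_hom: "qmr_rel p q \<Longrightarrow> dense_hom p" "qmr_rel p q \<Longrightarrow> dense_hom q"
  by (simp_all add: qmr_rel_def)

lemma dense_hom_zero: "dense_hom (UNIV :: 'a::prime_ring set, \<lambda>_. 0)"
  and dense_hom_one: "dense_hom (UNIV :: 'a::prime_ring set, \<lambda>x. x)"
  by (simp_all add: dense_hom_def dense_UNIV right_hom_on_def)

lemma dense_hom_add:
  assumes "dense_hom p" "dense_hom q"
  shows "dense_hom (fst p \<inter> fst q, \<lambda>x. snd p x + snd q x)"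
  using assms by (auto simp: dense_hom_def right_hom_on_def algebra_simps intro: dense_Int)

lemma dense_hom_uminus: "dense_hom p \<Longrightarrow> dense_hom (fst p, \<lambda>x. - snd p x)"
  by (auto simp: dense_hom_def right_hom_on_def)

lemma dense_hom_mult:
  assumes "dense_hom p" "dense_hom q"
  shows "dense_hom ({x \<in> fst q. snd q x \<in> fst p}, \<lambda>x. snd p (snd q x))"
  using assms by (auto simp: dense_hom_def right_hom_on_def intro: dense_preimage)

lemma dense_hom_left_mult: "dense_hom (UNIV, \<lambda>x. (a::'a::prime_ring) * x)"
  by (simp add: dense_hom_def dense_UNIV right_hom_on_def algebra_simps)

instantiation qmr :: (prime_ring) ring_1
begin

lift_definition zero_qmr :: "'a qmr" is "(UNIV, \<lambda>_. 0)"
  by (rule qmr_rel_refl[OF dense_hom_zero])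

lift_definition one_qmr :: "'a qmr" is "(UNIV, \<lambda>x. x)"
  by (rule qmr_rel_refl[OF dense_hom_one])

lift_definition plus_qmr :: "'a qmr \<Rightarrow> 'a qmr \<Rightarrow> 'a qmr" is
  "\<lambda>p q. (fst p \<inter> fst q, \<lambda>x. snd p x + snd q x)"
proof -
  fix p p' q q' :: "'a set \<times> ('a \<Rightarrow> 'a)"
  assume "qmr_rel p p'" "qmr_rel q q'"
  then obtain L M where *: "dense_hom p" "dense_hom p'" "dense_hom q" "dense_hom q'"
    "dense_right_ideal L" "L \<subseteq> fst p \<inter> fst p'" "\<forall>x\<in>L. snd p x = snd p' x"
    "dense_right_ideal M" "M \<subseteq> fst q \<inter> fst q'" "\<forall>x\<in>M. snd q x = snd q' x"
    unfolding qmr_rel_def by blast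
  show "qmr_rel (fst p \<inter> fst q, \<lambda>x. snd p x + snd q x) (fst p' \<inter> fst q', \<lambda>x. snd p' x + snd q' x)"
    by (rule qmr_relI[where L = "L \<inter> M"]) (use * in \<open>auto intro: dense_Int dense_hom_add\<close>)
qed

lift_definition uminus_qmr :: "'a qmr \<Rightarrow> 'a qmr" is "\<lambda>p. (fst p, \<lambda>x. - snd p x)"
  unfolding qmr_rel_def by (auto intro: dense_hom_uminus)

definition minus_qmr :: "'a qmr \<Rightarrow> 'a qmr \<Rightarrow> 'a qmr" where
  "minus_qmr p q = p + - q"

lift_definition times_qmr :: "'a qmr \<Rightarrow> 'a qmr \<Rightarrow> 'a qmr" is
  "\<lambda>p q. ({x \<in> fst q. snd q x \<in> fst p}, \<lambda>x. snd p (snd q x))"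
proof -
  fix p p' q q' :: "'a set \<times> ('a \<Rightarrow> 'a)"
  assume "qmr_rel p p'" "qmr_rel q q'"
  then obtain L M where *: "dense_hom p" "dense_hom p'" "dense_hom q" "dense_hom q'"
    "dense_right_ideal L" "L \<subseteq> fst p \<inter> fst p'" "\<forall>x\<in>L. snd p x = snd p' x"
    "dense_right_ideal M" "M \<subseteq> fst q \<inter> fst q'" "\<forall>x\<in>M. snd q x = snd q' x"
    unfolding qmr_rel_def by blast
  have "right_hom_on M (snd q)"
    using *(3,9) unfolding dense_hom_def right_hom_on_def by blast
  then have "dense_right_ideal {x \<in> M. snd q x \<in> L}"
    using * by (intro dense_preimage) auto
  then show "qmr_rel ({x \<in> fst q. snd q x \<in> fst p}, \<lambda>x. snd p (snd q x))
      ({x \<in> fst q'. snd q' x \<in> fst p'}, \<lambda>x. snd p' (snd q' x))"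
    by (rule qmr_relI[rotated 2]) (use * in \<open>auto intro: dense_hom_mult\<close>)
qed

instance
proof
  note dense_homs = dense_hom_zero dense_hom_one dense_hom_add dense_hom_uminus dense_hom_mult
    qmr_rel_dense_hom
  fix a b c :: "'a qmr"
  show "a + b + c = a + (b + c)"
    by (transfer, rule qmr_relI_Int; (intro dense_homs; assumption)?) (simp add: add.assoc)
  show "a + b = b + a"
    by (transfer, rule qmr_relI_Int; (intro dense_homs; assumption)?) (simp add: add.commute)
  show "0 + a = a"
    by (transfer, rule qmr_relI_Int; (intro dense_homs; assumption)?) simp
  show "- a + a = 0"
    by (transfer, rule qmr_relI_Int; (intro dense_homs; assumption)?) simp
  show "a - b = a + - b" by (simp add: minus_qmr_def)
  show "a * b * c = a * (b * c)"
    by (transfer, rule qmr_relI_Int; (intro dense_homs; assumption)?) simp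
  show "1 * a = a"
    by (transfer, rule qmr_relI_Int; (intro dense_homs; assumption)?) simp
  show "a * 1 = a"
    by (transfer, rule qmr_relI_Int; (intro dense_homs; assumption)?) simp
  show "(a + b) * c = a * c + b * c"
    by (transfer, rule qmr_relI_Int; (intro dense_homs; assumption)?) simp
  show "a * (b + c) = a * b + a * c"
    by (transfer, rule qmr_relI_Int; (intro dense_homs; assumption)?)
      (simp add: qmr_rel_def dense_hom_def right_hom_on_def)
  show "(0 :: 'a qmr) \<noteq> 1"
  proof transfer
    show "\<not> qmr_rel (UNIV :: 'a set, \<lambda>_. 0) (UNIV, \<lambda>x. x)"
    proof
      assume "qmr_rel (UNIV :: 'a set, \<lambda>_. 0) (UNIV, \<lambda>x. x)"
      then obtain L :: "'a set" where L: "dense_right_ideal L" "\<forall>x\<in>L. 0 = x"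
        by (auto simp: qmr_rel_def)
      obtain u :: 'a where "u \<noteq> 0" using nonzero by blast
      moreover have "u = 0"
        by (rule dense_annihilator[OF L(1)]) (use L(2) in \<open>metis mult_zero_right\<close>)
      ultimately show False by simp
    qed
  qed
qed

end


text \<open>The embedding of \<open>R\<close> into its ring of quotients, by left multiplications.\<close>

lift_definition qmr_of :: "'a::prime_ring \<Rightarrow> 'a qmr" is "\<lambda>a. (UNIV, \<lambda>x. a * x)"
  by (rule qmr_rel_refl[OF dense_hom_left_mult])

lemma qmr_of_add: "qmr_of (a + b) = qmr_of a + qmr_of b"
  by (transfer, rule qmr_relI_Int; (intro dense_hom_add dense_hom_left_mult)?)
    (simp add: distrib_right)

lemma qmr_of_mult: "qmr_of (a * b) = qmr_of a * qmr_of b"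
  by (transfer, rule qmr_relI_Int; (intro dense_hom_mult dense_hom_left_mult)?)
    (simp add: mult.assoc)

lemma qmr_of_zero: "qmr_of 0 = 0"
  by (metis add_0_right add_left_cancel qmr_of_add)

lemma qmr_of_eq_0: "qmr_of a = 0 \<Longrightarrow> a = 0"
proof transfer
  fix a :: 'a
  assume "qmr_rel (UNIV, \<lambda>x. a * x) (UNIV, \<lambda>_. 0)"
  then obtain L where L: "dense_right_ideal L" "\<forall>x\<in>L. a * x = 0"
    by (auto simp: qmr_rel_def)
  show "a = 0" by (rule dense_annihilator[OF L(1)]) (use L(2) in auto)
qed

lemma qmr_of_diff: "qmr_of (a - b) = qmr_of a - qmr_of b"
  by (metis add_diff_cancel_right' diff_add_cancel qmr_of_add)

lemma qmr_of_inject: "qmr_of a = qmr_of b \<longleftrightarrow> a = b"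
  by (metis eq_iff_diff_eq_0 qmr_of_diff qmr_of_eq_0)

lemma qmr_rel_mult_qmr_of:
  assumes "dense_hom q" "x \<in> fst q"
  shows "qmr_rel ({z \<in> fst (UNIV :: 'a set, \<lambda>z. x * z). snd (UNIV :: 'a set, \<lambda>z. x * z) z \<in> fst q},
      \<lambda>z. snd q (snd (UNIV :: 'a set, \<lambda>z. x * z) z)) (UNIV :: 'a::prime_ring set, \<lambda>z. snd q x * z)"
proof (rule qmr_relI_Int)
  show "dense_hom ({z \<in> fst (UNIV :: 'a set, \<lambda>z. x * z). snd (UNIV :: 'a set, \<lambda>z. x * z) z \<in> fst q},
      \<lambda>z. snd q (snd (UNIV :: 'a set, \<lambda>z. x * z) z))"
    by (rule dense_hom_mult[OF assms(1) dense_hom_left_mult])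
  show "dense_hom (UNIV :: 'a set, \<lambda>z. snd q x * z)" by (rule dense_hom_left_mult)
qed (use assms in \<open>simp add: dense_hom_def right_hom_on_def\<close>)

text \<open>The next three facts determine the ring of quotients up to isomorphism over \<open>R\<close>.\<close>

lemma qmr_denominator: "\<exists>J. dense_right_ideal J \<and> (\<forall>x\<in>J. \<exists>y. q * qmr_of x = qmr_of y)"
proof transfer
  fix q :: "'a set \<times> ('a \<Rightarrow> 'a)"
  assume "qmr_rel q q"
  then have d: "dense_hom q" by (simp add: qmr_rel_def)
  show "\<exists>J. dense_right_ideal J \<and> (\<forall>x\<in>J. \<exists>y.
      qmr_rel ({z \<in> fst (UNIV :: 'a set, \<lambda>z. x * z). snd (UNIV :: 'a set, \<lambda>z. x * z) z \<in> fst q},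
        \<lambda>z. snd q (snd (UNIV :: 'a set, \<lambda>z. x * z) z)) (UNIV :: 'a set, \<lambda>z. y * z))"
  proof (intro exI[of _ "fst q"] conjI ballI)
    show "dense_right_ideal (fst q)" using d by (simp add: dense_hom_def)
    fix x assume "x \<in> fst q"
    then show "\<exists>y. qmr_rel ({z \<in> fst (UNIV :: 'a set, \<lambda>z. x * z). snd (UNIV :: 'a set, \<lambda>z. x * z) z \<in> fst q},
        \<lambda>z. snd q (snd (UNIV :: 'a set, \<lambda>z. x * z) z)) (UNIV :: 'a set, \<lambda>z. y * z)"
      by (intro exI) (rule qmr_rel_mult_qmr_of[OF d])
  qed
qed

lemma qmr_annihilator:
  assumes "dense_right_ideal J" "\<And>x. x \<in> J \<Longrightarrow> q * qmr_of x = 0"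
  shows "q = 0"
  using assms
proof (transfer fixing: J)
  fix q :: "'a set \<times> ('a \<Rightarrow> 'a)"
  assume q: "qmr_rel q q" and J: "dense_right_ideal J"
    and 0: "\<And>x. x \<in> J \<Longrightarrow> qmr_rel ({z \<in> fst (UNIV :: 'a set, \<lambda>z. x * z). snd (UNIV :: 'a set, \<lambda>z. x * z) z \<in> fst q},
        \<lambda>z. snd q (snd (UNIV :: 'a set, \<lambda>z. x * z) z)) (UNIV :: 'a set, \<lambda>_. 0)"
  have d: "dense_hom q" using q by (simp add: qmr_rel_def)
  have "snd q x = 0" if x: "x \<in> J" "x \<in> fst q" for x
  proof -
    obtain L where L: "dense_right_ideal L" "\<forall>z\<in>L. snd q (x * z) = 0"
      using 0[OF x(1)] by (auto simp: qmr_rel_def)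
    show ?thesis
      by (rule dense_annihilator[OF L(1)])
        (use L(2) d x(2) in \<open>simp add: dense_hom_def right_hom_on_def\<close>)
  qed
  then show "qmr_rel q (UNIV :: 'a set, \<lambda>_. 0)"
    using d J by (intro qmr_relI[where L = "J \<inter> fst q"] dense_hom_zero dense_Int)
      (auto simp: dense_hom_def)
qed

lemma qmr_complete:
  assumes "dense_right_ideal J" "right_hom_on J f"
  shows "\<exists>q. \<forall>x\<in>J. q * qmr_of x = qmr_of (f x)"
proof (transfer fixing: J f)
  have d: "dense_hom (J, f)" using assms by (simp add: dense_hom_def)
  show "\<exists>q\<in>{q. qmr_rel q q}. \<forall>x\<in>J. qmr_rel ({z \<in> fst (UNIV :: 'a set, \<lambda>z. x * z). snd (UNIV :: 'a set, \<lambda>z. x * z) z \<in> fst q},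
        \<lambda>z. snd q (snd (UNIV :: 'a set, \<lambda>z. x * z) z)) (UNIV :: 'a set, \<lambda>z. f x * z)"
    using qmr_rel_refl[OF d] qmr_rel_mult_qmr_of[OF d]
    by (intro bexI[of _ "(J, f)"] ballI) simp_all
qed

definition extended_centroid :: "'a::prime_ring qmr set" where
  "extended_centroid = ring_center"

text \<open>The central closure \<open>R C + C\<close>.\<close>

definition central_closure :: "'a::prime_ring qmr set" where
  "central_closure = {(\<Sum>i<n. qmr_of (r i) * c i) + d | (n::nat) r c d.
     (\<forall>i<n. c i \<in> extended_centroid) \<and> d \<in> extended_centroid}"


lemma extended_centroid_commute: "c \<in> extended_centroid \<Longrightarrow> c * q = q * c"
  by (simp add: extended_centroid_def ring_center_def)

lemma extended_centroid_left_commute: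
  assumes "c \<in> extended_centroid"
  shows "c * (p * q) = p * (c * q)"
  by (simp only: mult.assoc[symmetric] extended_centroid_commute[OF assms, of p])

lemma extended_centroid_add:
  "c \<in> extended_centroid \<Longrightarrow> d \<in> extended_centroid \<Longrightarrow> c + d \<in> extended_centroid"
  by (simp add: extended_centroid_def ring_center_def distrib_left distrib_right)

lemma extended_centroid_mult:
  assumes "c \<in> extended_centroid" "d \<in> extended_centroid"
  shows "c * d \<in> extended_centroid"
proof -
  have "c * d * q = q * (c * d)" for q
  proof -
    have "c * d * q = c * q * d"
      by (simp only: mult.assoc extended_centroid_commute[OF assms(2), of q])
    also have "\<dots> = q * (c * d)"
      by (simp only: mult.assoc extended_centroid_commute[OF assms(1), of q])
    finally show ?thesis .
  qed
  then show ?thesis by (simp add: extended_centroid_def ring_center_def)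
qed

lemma central_closure_centroid: "d \<in> extended_centroid \<Longrightarrow> d \<in> central_closure"
  unfolding central_closure_def by (auto intro!: exI[of _ "0::nat"])

lemma central_closure_step:
  assumes "q \<in> central_closure" "c \<in> extended_centroid"
  shows "q + qmr_of r * c \<in> central_closure"
proof -
  obtain n :: nat and r' c' d where q: "q = (\<Sum>i<n. qmr_of (r' i) * c' i) + d"
    "\<forall>i<n. c' i \<in> extended_centroid" "d \<in> extended_centroid"
    using assms(1) unfolding central_closure_def by blast
  have "q + qmr_of r * c =
      (\<Sum>i<Suc n. qmr_of ((r'(n := r)) i) * (c'(n := c)) i) + d"
    by (simp add: q(1) add.assoc add.commute)
  moreover have "\<forall>i<Suc n. (c'(n := c)) i \<in> extended_centroid"
    using q(2) assms(2) by (simp add: less_Suc_eq)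
  ultimately show ?thesis unfolding central_closure_def using q(3) by blast
qed

lemma central_closure_induct [consumes 1, case_names centroid step]:
  assumes "q \<in> central_closure"
    and "\<And>d. d \<in> extended_centroid \<Longrightarrow> P d"
    and "\<And>q r c. q \<in> central_closure \<Longrightarrow> P q \<Longrightarrow> c \<in> extended_centroid \<Longrightarrow> P (q + qmr_of r * c)"
  shows "P q"
proof -
  have "(\<Sum>i<n. qmr_of (r i) * c i) + d \<in> central_closure \<and> P ((\<Sum>i<n. qmr_of (r i) * c i) + d)"
    if c: "\<forall>i<n. c i \<in> extended_centroid" and d: "d \<in> extended_centroid" for n :: nat and r c d
    using c
  proof (induction n)
    case 0
    then show ?case using assms(2) d central_closure_centroid by simp
  next
    case (Suc n)
    let ?q = "(\<Sum>i<n. qmr_of (r i) * c i) + d"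
    have IH: "?q \<in> central_closure \<and> P ?q" using Suc by simp
    have cn: "c n \<in> extended_centroid" using Suc.prems by simp
    have eq: "(\<Sum>i<Suc n. qmr_of (r i) * c i) + d = ?q + qmr_of (r n) * c n"
      by (simp add: add.assoc add.commute)
    show ?case
      unfolding eq using IH assms(3)[of ?q "c n" "r n"] central_closure_step[of ?q "c n" "r n"] cn
      by blast
  qed
  then show ?thesis using assms(1) unfolding central_closure_def by blast
qed

lemma central_closure_add:
  assumes "p \<in> central_closure" "q \<in> central_closure"
  shows "p + q \<in> central_closure"
  using assms(2)
proof (induction rule: central_closure_induct)
  case (centroid d)
  show ?case
    using assms(1)
  proof (induction rule: central_closure_induct)
    case (centroid e)
    then show ?case using \<open>d \<in> extended_centroid\<close>
      by (intro central_closure_centroid extended_centroid_add)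
  next
    case (step q r c)
    then show ?case using central_closure_step[of "q + d" c r] by (simp add: algebra_simps)
  qed
next
  case (step q r c)
  then show ?case using central_closure_step[of "p + q" c r] by (simp add: algebra_simps)
qed

lemma central_closure_term: "c \<in> extended_centroid \<Longrightarrow> qmr_of r * c \<in> central_closure"
  using central_closure_step[OF central_closure_centroid, of 0 c r]
  by (simp add: extended_centroid_def ring_center_def)

lemma central_closure_qmr_of: "qmr_of r \<in> central_closure"
  using central_closure_term[of 1 r] by (simp add: extended_centroid_def ring_center_def)

lemma central_closure_mult:
  assumes "p \<in> central_closure" "q \<in> central_closure"
  shows "p * q \<in> central_closure"
  using assms(2)
proof (induction rule: central_closure_induct)
  case (centroid d)
  show ?case
    using assms(1)
  proof (induction rule: central_closure_induct)
    case (centroid e)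
    then show ?case using \<open>d \<in> extended_centroid\<close>
      by (intro central_closure_centroid extended_centroid_mult)
  next
    case (step q r c)
    then show ?case
      using central_closure_term[OF extended_centroid_mult[OF step.hyps(2) \<open>d \<in> extended_centroid\<close>], of r]
      by (simp add: distrib_right central_closure_add mult.assoc)
  qed
next
  case (step q r c)
  have "p * (qmr_of r * c) \<in> central_closure"
    using assms(1)
  proof (induction rule: central_closure_induct)
    case (centroid e)
    have "e * (qmr_of r * c) = qmr_of r * (e * c)"
      by (rule extended_centroid_left_commute[OF centroid])
    then show ?case
      using central_closure_term[OF extended_centroid_mult[OF centroid step.hyps(2)]] by simp
  next
    case (step p s b)
    have "qmr_of s * b * (qmr_of r * c) = qmr_of (s * r) * (b * c)"
      by (simp only: qmr_of_mult mult.assoc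
          extended_centroid_left_commute[OF step.hyps(2), of "qmr_of r"])
    then show ?case
      using central_closure_term[OF extended_centroid_mult[OF step.hyps(2) \<open>c \<in> extended_centroid\<close>]] step
      by (simp add: distrib_right central_closure_add)
  qed
  then show ?case using step by (simp add: distrib_left central_closure_add)
qed

section \<open>Extending the involution to the central closure\<close>

definition extends_involution ::
    "('a::prime_ring \<Rightarrow> 'a) \<Rightarrow> ('a qmr \<Rightarrow> 'a qmr) \<Rightarrow> bool" where
  "extends_involution star f \<longleftrightarrow>
     involution_on central_closure f \<and> (\<forall>x. f (qmr_of x) = qmr_of (star x))"

text \<open>The choice is determined on the central closure, by \<open>extends_involution_exists\<close> and
  \<open>extends_involution_unique\<close> below.\<close>

definition ext_involution :: "('a::prime_ring \<Rightarrow> 'a) \<Rightarrow> 'a qmr \<Rightarrow> 'a qmr" where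
  "ext_involution star = (SOME f. extends_involution star f)"


lemma qmr_annihilator_eq:
  assumes "dense_right_ideal J" "\<And>x. x \<in> J \<Longrightarrow> p * qmr_of x = q * qmr_of x"
  shows "p = q"
  using qmr_annihilator[OF assms(1), of "p - q"] assms(2) by (simp add: left_diff_distrib)

text \<open>Two-sided ideals that are dense; in a prime ring these are exactly the nonzero ones.\<close>

definition dense_ideal :: "'a::ring set \<Rightarrow> bool" where
  "dense_ideal I \<longleftrightarrow> dense_right_ideal I \<and> (\<forall>x\<in>I. \<forall>r. r * x \<in> I)"

lemma dense_idealI:
  fixes a :: "'a::prime_ring"
  assumes "right_ideal I" "\<And>x r. x \<in> I \<Longrightarrow> r * x \<in> I" "a \<in> I" "a \<noteq> 0"
  shows "dense_ideal I"
proof -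
  have "\<exists>r. x * r \<noteq> 0 \<and> y * r \<in> I" if x: "x \<noteq> 0" for x y
  proof -
    obtain r where "x * r * a \<noteq> 0" using prime[of x a] x assms(4) by blast
    moreover have "y * (r * a) \<in> I" using assms(2,3) by blast
    ultimately show ?thesis by (metis mult.assoc)
  qed
  then show ?thesis using assms by (simp add: dense_ideal_def dense_right_ideal_def)
qed

lemma dense_ideal_nonzero:
  fixes I :: "'a::prime_ring set"
  assumes "dense_ideal I"
  obtains a where "a \<in> I" "a \<noteq> 0"
proof -
  obtain u :: 'a where "u \<noteq> 0" using nonzero by blast
  then show ?thesis
    using that dense_right_ideal_ex[of I u u] assms unfolding dense_ideal_def by blast
qed

lemma dense_ideal_Int: "dense_ideal I \<Longrightarrow> dense_ideal K \<Longrightarrow> dense_ideal (I \<inter> K)"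
  by (auto simp: dense_ideal_def intro: dense_Int)

lemma dense_ideal_UNIV: "dense_ideal (UNIV :: 'a::prime_ring set)"
  by (simp add: dense_ideal_def dense_UNIV)

lemma dense_ideal_left_annihilator:
  assumes I: "dense_ideal I" and 0: "\<And>x. x \<in> I \<Longrightarrow> qmr_of x * q = 0"
  shows "q = 0"
proof -
  obtain J where J: "dense_right_ideal J" "\<And>x. x \<in> J \<Longrightarrow> \<exists>y. q * qmr_of x = qmr_of y"
    using qmr_denominator by blast
  obtain a where a: "a \<in> I" "a \<noteq> 0" using dense_ideal_nonzero[OF I] .
  show ?thesis
  proof (rule qmr_annihilator[OF J(1)])
    fix x assume "x \<in> J"
    then obtain y where y: "q * qmr_of x = qmr_of y" using J(2) by blast
    have "a * r * y = 0" for r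
    proof -
      have "a * r \<in> I" using I a(1) dense_closed(5) by (auto simp: dense_ideal_def)
      then have "qmr_of (a * r * y) = 0"
        using 0[of "a * r"] y by (metis mult.assoc mult_zero_left qmr_of_mult)
      then show ?thesis by (rule qmr_of_eq_0)
    qed
    then have "y = 0" using prime a(2) by blast
    then show "q * qmr_of x = 0" using y by (simp add: qmr_of_zero)
  qed
qed

lemma ring_center_qmrI:
  assumes "\<And>r. c * qmr_of r = qmr_of r * c"
  shows "c \<in> ring_center"
proof -
  have "c * q = q * c" for q
  proof -
    obtain J where J: "dense_right_ideal J" "\<And>x. x \<in> J \<Longrightarrow> \<exists>y. q * qmr_of x = qmr_of y"
      using qmr_denominator by blast
    show ?thesis
      by (rule qmr_annihilator_eq[OF J(1)]) (use J(2) assms in \<open>metis mult.assoc\<close>)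
  qed
  then show ?thesis by (simp add: ring_center_def)
qed

text \<open>\<open>conj_at star q p I\<close>: the element \<open>p\<close> acts on \<open>star ` I\<close> as the image of \<open>q\<close> must.\<close>

definition conj_at ::
    "('a::prime_ring \<Rightarrow> 'a) \<Rightarrow> 'a qmr \<Rightarrow> 'a qmr \<Rightarrow> 'a set \<Rightarrow> bool" where
  "conj_at star q p I \<longleftrightarrow>
     (\<forall>x\<in>I. \<exists>y. qmr_of x * q = qmr_of y \<and> p * qmr_of (star x) = qmr_of (star y))"

definition symmetric :: "'a::prime_ring qmr \<Rightarrow> bool" where
  "symmetric q \<longleftrightarrow> (\<exists>I. dense_ideal I \<and>
     (\<forall>x\<in>I. (\<exists>y. qmr_of x * q = qmr_of y) \<and> (\<exists>y. q * qmr_of x = qmr_of y)))"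

lemma symmetric_centroid:
  assumes "c \<in> extended_centroid"
  shows "symmetric c"
proof -
  have c: "c * q = q * c" for q using assms by (simp add: extended_centroid_def ring_center_def)
  define I where "I = {x. \<exists>y. c * qmr_of x = qmr_of y}"
  have "right_ideal I"
    unfolding right_ideal_def
  proof (intro conjI ballI allI)
    show "0 \<in> I" by (auto simp: I_def qmr_of_zero intro!: exI[of _ 0])
    fix x assume "x \<in> I"
    then obtain x' where x': "c * qmr_of x = qmr_of x'" by (auto simp: I_def)
    show "x * r \<in> I" for r
      unfolding I_def using x' by (auto intro!: exI[of _ "x' * r"] simp: qmr_of_mult mult.assoc[symmetric])
    fix y assume "y \<in> I"
    then obtain y' where y': "c * qmr_of y = qmr_of y'" by (auto simp: I_def)
    show "x - y \<in> I"
      unfolding I_def using x' y' by (auto intro!: exI[of _ "x' - y'"] simp: qmr_of_diff right_diff_distrib)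
  qed
  moreover have "r * x \<in> I" if x: "x \<in> I" for r x
  proof -
    obtain x' where "c * qmr_of x = qmr_of x'" using x by (auto simp: I_def)
    then have "c * qmr_of (r * x) = qmr_of (r * x')" by (metis c mult.assoc qmr_of_mult)
    then show ?thesis by (auto simp: I_def)
  qed
  moreover obtain a where "a \<in> I" "a \<noteq> 0"
  proof -
    obtain J where J: "dense_right_ideal J" "\<And>x. x \<in> J \<Longrightarrow> \<exists>y. c * qmr_of x = qmr_of y"
      using qmr_denominator by blast
    obtain u :: 'a where u: "u \<noteq> 0" using nonzero by blast
    then obtain r where "u * r \<noteq> 0" "u * r \<in> J" using dense_right_ideal_ex[OF J(1) u] by blast
    then show ?thesis by (intro that[of "u * r"]) (use J(2) in \<open>simp_all add: I_def\<close>)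
  qed
  ultimately have "dense_ideal I" by (blast intro: dense_idealI)
  then show ?thesis
    unfolding symmetric_def using c by (intro exI[of _ I]) (auto simp: I_def)
qed

lemma symmetric_qmr_of: "symmetric (qmr_of a)"
  unfolding symmetric_def
  by (intro exI[of _ UNIV]) (auto simp: dense_ideal_UNIV qmr_of_mult[symmetric] qmr_of_inject)

lemma symmetric_add:
  assumes "symmetric p" "symmetric q"
  shows "symmetric (p + q)"
proof -
  obtain I K where I: "dense_ideal I" and K: "dense_ideal K"
    and p: "\<forall>x\<in>I. (\<exists>y. qmr_of x * p = qmr_of y) \<and> (\<exists>y. p * qmr_of x = qmr_of y)"
    and q: "\<forall>x\<in>K. (\<exists>y. qmr_of x * q = qmr_of y) \<and> (\<exists>y. q * qmr_of x = qmr_of y)"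
    using assms unfolding symmetric_def by blast
  show ?thesis
    unfolding symmetric_def
  proof (intro exI[of _ "I \<inter> K"] conjI ballI)
    show "dense_ideal (I \<inter> K)" by (rule dense_ideal_Int[OF I K])
    fix x assume "x \<in> I \<inter> K"
    then obtain y z y' z' where "qmr_of x * p = qmr_of y" "p * qmr_of x = qmr_of y'"
      "qmr_of x * q = qmr_of z" "q * qmr_of x = qmr_of z'"
      using p q by blast
    then have "qmr_of x * (p + q) = qmr_of (y + z)" "(p + q) * qmr_of x = qmr_of (y' + z')"
      by (simp_all add: distrib_left distrib_right qmr_of_add)
    then show "\<exists>w. qmr_of x * (p + q) = qmr_of w" "\<exists>w. (p + q) * qmr_of x = qmr_of w"
      by blast+
  qed
qed

lemma dense_ideal_mult_annihilator:
  assumes "dense_ideal I" "dense_ideal K"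
    "\<And>x y. x \<in> I \<Longrightarrow> y \<in> K \<Longrightarrow> p * qmr_of (x * y) = q * qmr_of (x * y)"
  shows "p = q"
proof (rule qmr_annihilator_eq)
  show "dense_right_ideal I" using assms(1) by (simp add: dense_ideal_def)
  fix x assume x: "x \<in> I"
  show "p * qmr_of x = q * qmr_of x"
  proof (rule qmr_annihilator_eq)
    show "dense_right_ideal K" using assms(2) by (simp add: dense_ideal_def)
    fix y assume "y \<in> K"
    then show "p * qmr_of x * qmr_of y = q * qmr_of x * qmr_of y"
      using assms(3)[OF x] by (metis mult.assoc qmr_of_mult)
  qed
qed

context
  fixes star :: "'a::prime_ring \<Rightarrow> 'a"
  assumes star: "involution star"
begin

lemma star_add: "star (x + y) = star x + star y"
  and star_mult: "star (x * y) = star y * star x"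
  and star_star: "star (star x) = x"
  using star by (simp_all add: involution_on_def)

lemma star_zero: "star 0 = 0"
  by (metis add_cancel_right_left star_add)

lemma star_diff: "star (x - y) = star x - star y"
  by (metis add_diff_cancel_right' diff_add_cancel star_add)

lemma dense_ideal_star:
  assumes I: "dense_ideal I"
  shows "dense_ideal (star ` I)"
proof -
  obtain a where a: "a \<in> I" "a \<noteq> 0" using dense_ideal_nonzero[OF I] .
  have r: "dense_right_ideal I" using I by (simp add: dense_ideal_def)
  show ?thesis
  proof (rule dense_idealI)
    show "right_ideal (star ` I)"
      unfolding right_ideal_def
    proof (intro conjI ballI allI)
      show "0 \<in> star ` I" using dense_closed(1)[OF r] star_zero by (metis imageI)
      fix x assume "x \<in> star ` I"
      then obtain x' where x': "x = star x'" "x' \<in> I" by blast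
      have "x * r = star (star r * x')" for r by (simp add: x' star_mult star_star)
      then show "x * r \<in> star ` I" for r using x' I by (auto simp: dense_ideal_def)
      fix y assume "y \<in> star ` I"
      then obtain y' where y': "y = star y'" "y' \<in> I" by blast
      then show "x - y \<in> star ` I"
        using x' dense_closed(2)[OF r] by (auto simp: star_diff[symmetric])
    qed
    show "r * x \<in> star ` I" if x: "x \<in> star ` I" for x r
    proof -
      obtain x' where x': "x = star x'" "x' \<in> I" using x by blast
      have "r * x = star (x' * star r)" by (simp add: x' star_mult star_star)
      then show ?thesis using x' dense_closed(5)[OF r] by auto
    qed
    show "star a \<in> star ` I" using a by blast
    show "star a \<noteq> 0" using a by (metis star_star star_zero)
  qed
qed

lemma conj_at_exists:
  assumes "symmetric q"
  shows "\<exists>p I. dense_ideal I \<and> conj_at star q p I"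
proof -
  obtain I where I: "dense_ideal I" "\<forall>x\<in>I. \<exists>y. qmr_of x * q = qmr_of y"
    using assms unfolding symmetric_def by blast
  then obtain g where g: "\<And>x. x \<in> I \<Longrightarrow> qmr_of x * q = qmr_of (g x)" by metis
  have r: "dense_right_ideal I" using I by (simp add: dense_ideal_def)
  have add: "g (x + y) = g x + g y" if "x \<in> I" "y \<in> I" for x y
  proof -
    have "x + y \<in> I" using that dense_closed(4)[OF r] by blast
    then have "qmr_of (g (x + y)) = qmr_of (g x + g y)"
      using that by (simp add: g[symmetric] qmr_of_add distrib_right)
    then show ?thesis by (simp add: qmr_of_inject)
  qed
  have mult: "g (s * x) = s * g x" if "x \<in> I" for x s
  proof -
    have "s * x \<in> I" using I(1) that by (auto simp: dense_ideal_def)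
    then have "qmr_of (g (s * x)) = qmr_of (s * g x)"
      using that by (simp add: g[symmetric] qmr_of_mult mult.assoc)
    then show ?thesis by (simp add: qmr_of_inject)
  qed
  define f where "f z = star (g (star z))" for z
  have "right_hom_on (star ` I) f"
    by (auto simp: right_hom_on_def f_def star_add star_mult star_star add mult)
  then obtain p where p: "\<forall>z\<in>star ` I. p * qmr_of z = qmr_of (f z)"
    using qmr_complete dense_ideal_star[OF I(1)] unfolding dense_ideal_def by blast
  have "conj_at star q p I"
    using g p by (auto simp: conj_at_def f_def star_star)
  then show ?thesis using I(1) by blast
qed

definition qstar :: "'a qmr \<Rightarrow> 'a qmr" where
  "qstar q = (SOME p. \<exists>I. dense_ideal I \<and> conj_at star q p I)"

lemma qstar:
  assumes "symmetric q"
  obtains I where "dense_ideal I" "conj_at star q (qstar q) I"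
  using someI_ex[OF conj_at_exists[OF assms]] unfolding qstar_def by blast

lemma conj_at_val:
  "conj_at star q p I \<Longrightarrow> x \<in> I \<Longrightarrow> qmr_of x * q = qmr_of y \<Longrightarrow> p * qmr_of (star x) = qmr_of (star y)"
  unfolding conj_at_def by (metis qmr_of_inject)

lemma conj_at_ex: "conj_at star q p I \<Longrightarrow> x \<in> I \<Longrightarrow> \<exists>y. qmr_of x * q = qmr_of y"
  unfolding conj_at_def by blast

lemma conj_at_unique:
  assumes "symmetric q" "dense_ideal I" "conj_at star q p I"
  shows "qstar q = p"
proof -
  obtain K where K: "dense_ideal K" "conj_at star q (qstar q) K" using qstar[OF assms(1)] .
  have d: "dense_ideal (star ` (I \<inter> K))" by (intro dense_ideal_star dense_ideal_Int assms K)
  show ?thesis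
  proof (rule qmr_annihilator_eq)
    show "dense_right_ideal (star ` (I \<inter> K))" using d by (simp add: dense_ideal_def)
    fix z assume "z \<in> star ` (I \<inter> K)"
    then obtain x where x: "z = star x" "x \<in> I" "x \<in> K" by blast
    obtain y where "qmr_of x * q = qmr_of y" using conj_at_ex[OF K(2) x(3)] by blast
    then show "qstar q * qmr_of z = p * qmr_of z"
      using conj_at_val[OF assms(3) x(2)] conj_at_val[OF K(2) x(3)] x(1) by simp
  qed
qed

lemma qstar_qmr_of: "qstar (qmr_of a) = qmr_of (star a)"
  by (rule conj_at_unique[OF symmetric_qmr_of dense_ideal_UNIV])
    (auto simp: conj_at_def star_mult qmr_of_mult[symmetric] qmr_of_inject)

lemma qstar_add:
  assumes "symmetric p" "symmetric q"
  shows "qstar (p + q) = qstar p + qstar q"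
proof -
  obtain I where I: "dense_ideal I" "conj_at star p (qstar p) I" using qstar[OF assms(1)] .
  obtain K where K: "dense_ideal K" "conj_at star q (qstar q) K" using qstar[OF assms(2)] .
  have "conj_at star (p + q) (qstar p + qstar q) (I \<inter> K)"
    unfolding conj_at_def
  proof
    fix x assume "x \<in> I \<inter> K"
    then obtain y z where "qmr_of x * p = qmr_of y" "qstar p * qmr_of (star x) = qmr_of (star y)"
      "qmr_of x * q = qmr_of z" "qstar q * qmr_of (star x) = qmr_of (star z)"
      using I(2) K(2) unfolding conj_at_def by blast
    then show "\<exists>w. qmr_of x * (p + q) = qmr_of w \<and>
        (qstar p + qstar q) * qmr_of (star x) = qmr_of (star w)"
      by (intro exI[of _ "y + z"]) (simp add: distrib_left distrib_right qmr_of_add star_add)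
  qed
  then show ?thesis
    by (intro conj_at_unique[where I = "I \<inter> K"] symmetric_add dense_ideal_Int assms I K)
qed

lemma qstar_mult:
  assumes "symmetric p" "symmetric q" "symmetric (p * q)"
  shows "qstar (p * q) = qstar q * qstar p"
proof -
  obtain I where I: "dense_ideal I" "conj_at star p (qstar p) I" using qstar[OF assms(1)] .
  obtain K where K: "dense_ideal K" "conj_at star q (qstar q) K" using qstar[OF assms(2)] .
  obtain M where M: "dense_ideal M" "conj_at star (p * q) (qstar (p * q)) M"
    using qstar[OF assms(3)] .
  have *: "qstar (p * q) * qmr_of (star (z * w)) = qstar q * qstar p * qmr_of (star (z * w))"
    if z: "z \<in> K" and w: "w \<in> I \<inter> M" for z w
  proof -
    obtain y where y: "qmr_of w * p = qmr_of y" using conj_at_ex[OF I(2)] w by blast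
    have zy: "qmr_of (z * w) * p = qmr_of (z * y)" by (simp only: qmr_of_mult mult.assoc y)
    have "z * w \<in> I" "z * w \<in> M" "z * y \<in> K"
      using z w I(1) K(1) M(1) dense_closed(5) by (auto simp: dense_ideal_def)
    note zw = this
    obtain t where t: "qmr_of (z * y) * q = qmr_of t" using conj_at_ex[OF K(2) zw(3)] by blast
    have "qmr_of (z * w) * (p * q) = qmr_of t" using zy t by (simp add: mult.assoc[symmetric])
    then have "qstar (p * q) * qmr_of (star (z * w)) = qmr_of (star t)"
      by (rule conj_at_val[OF M(2) zw(2)])
    also have "\<dots> = qstar q * qmr_of (star (z * y))"
      by (rule conj_at_val[OF K(2) zw(3) t, symmetric])
    also have "\<dots> = qstar q * (qstar p * qmr_of (star (z * w)))"
      by (simp only: conj_at_val[OF I(2) zw(1) zy])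
    finally show ?thesis by (simp only: mult.assoc)
  qed
  show ?thesis
  proof (rule dense_ideal_mult_annihilator)
    show "dense_ideal (star ` (I \<inter> M))" "dense_ideal (star ` K)"
      by (intro dense_ideal_star dense_ideal_Int I K M)+
    fix x y assume "x \<in> star ` (I \<inter> M)" "y \<in> star ` K"
    then show "qstar (p * q) * qmr_of (x * y) = qstar q * qstar p * qmr_of (x * y)"
      using * by (auto simp: star_mult)
  qed
qed

lemma symmetric_central_closure:
  assumes "q \<in> central_closure"
  shows "symmetric q"
  using assms
proof (induction rule: central_closure_induct)
  case (centroid d)
  then show ?case by (rule symmetric_centroid)
next
  case (step q r c)
  obtain I where I: "dense_ideal I"
    "\<forall>x\<in>I. (\<exists>y. qmr_of x * c = qmr_of y) \<and> (\<exists>y. c * qmr_of x = qmr_of y)"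
    using symmetric_centroid[OF step.hyps(2)] unfolding symmetric_def by blast
  have "symmetric (qmr_of r * c)"
    unfolding symmetric_def
  proof (intro exI[of _ I] conjI ballI)
    fix x assume x: "x \<in> I"
    have "x * r \<in> I" using x I(1) dense_closed(5) by (auto simp: dense_ideal_def)
    then obtain y where "qmr_of (x * r) * c = qmr_of y" using I(2) by blast
    then show "\<exists>y. qmr_of x * (qmr_of r * c) = qmr_of y"
      by (intro exI[of _ y]) (simp add: qmr_of_mult mult.assoc)
    obtain y where "c * qmr_of x = qmr_of y" using I(2) x by blast
    then show "\<exists>y. qmr_of r * c * qmr_of x = qmr_of y"
      by (intro exI[of _ "r * y"]) (simp add: qmr_of_mult mult.assoc)
  qed (rule I(1))
  then show ?case by (rule symmetric_add[OF step.IH])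
qed

lemma qstar_closure_mult:
  "p \<in> central_closure \<Longrightarrow> q \<in> central_closure \<Longrightarrow> qstar (p * q) = qstar q * qstar p"
  by (rule qstar_mult) (simp_all add: symmetric_central_closure central_closure_mult)

lemma qstar_centroid:
  assumes c: "c \<in> extended_centroid"
  shows "qstar c \<in> extended_centroid"
  unfolding extended_centroid_def
proof (rule ring_center_qmrI)
  fix r
  have "qstar (qmr_of (star r) * c) = qstar (c * qmr_of (star r))"
    using extended_centroid_commute[OF c] by simp
  then show "qstar c * qmr_of r = qmr_of r * qstar c"
    using c by (simp add: qstar_closure_mult central_closure_qmr_of central_closure_centroid
        qstar_qmr_of star_star)
qed

lemma qstar_closure:
  assumes "q \<in> central_closure"
  shows "qstar q \<in> central_closure"
  using assms
proof (induction rule: central_closure_induct)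
  case (centroid d)
  then show ?case by (intro central_closure_centroid qstar_centroid)
next
  case (step q r c)
  have "qstar (q + qmr_of r * c) = qstar q + qmr_of (star r) * qstar c"
    using step.hyps qstar_add[of q "qmr_of r * c"] qstar_closure_mult[of "qmr_of r" c]
      extended_centroid_commute[OF qstar_centroid[OF step.hyps(2)], of "qmr_of (star r)"]
    by (simp add: symmetric_central_closure central_closure_term central_closure_qmr_of
        central_closure_centroid qstar_qmr_of)
  then show ?case using step by (simp add: central_closure_step qstar_centroid)
qed

lemma qstar_qstar:
  assumes q: "q \<in> central_closure"
  shows "qstar (qstar q) = q"
proof -
  obtain I where I: "dense_ideal I" "conj_at star q (qstar q) I"
    using qstar[OF symmetric_central_closure[OF q]] .
  have "qmr_of x * (qstar (qstar q) - q) = 0" if x: "x \<in> I" for x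
  proof -
    obtain y where y: "qmr_of x * q = qmr_of y" "qstar q * qmr_of (star x) = qmr_of (star y)"
      using I(2) x unfolding conj_at_def by blast
    have "qstar (qmr_of (star y)) = qstar (qmr_of (star x)) * qstar (qstar q)"
      using y(2) qstar_closure_mult[OF qstar_closure[OF q] central_closure_qmr_of] by metis
    then show ?thesis
      using y(1) by (simp add: qstar_qmr_of star_star right_diff_distrib)
  qed
  then have "qstar (qstar q) - q = 0" by (rule dense_ideal_left_annihilator[OF I(1)])
  then show ?thesis by simp
qed

theorem extends_involution_exists: "\<exists>f. extends_involution star f"
  unfolding extends_involution_def involution_on_def
  by (intro exI[of _ qstar] conjI ballI allI)
    (simp_all add: qstar_closure qstar_add symmetric_central_closure qstar_closure_mult
      qstar_qstar qstar_qmr_of)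

lemma extends_involution_qstar:
  assumes f: "extends_involution star f" and q: "q \<in> central_closure"
  shows "f q = qstar q"
proof -
  obtain I where I: "dense_ideal I" "conj_at star q (qstar q) I"
    using qstar[OF symmetric_central_closure[OF q]] .
  have "conj_at star q (f q) I"
    unfolding conj_at_def
  proof
    fix x assume "x \<in> I"
    then obtain y where y: "qmr_of x * q = qmr_of y" using conj_at_ex[OF I(2)] by blast
    have "f (qmr_of x * q) = f q * f (qmr_of x)"
      using f q central_closure_qmr_of unfolding extends_involution_def involution_on_def by blast
    then have "f q * qmr_of (star x) = qmr_of (star y)"
      using f y by (simp add: extends_involution_def)
    then show "\<exists>y. qmr_of x * q = qmr_of y \<and> f q * qmr_of (star x) = qmr_of (star y)"
      using y by blast
  qed
  then show ?thesis
    using conj_at_unique[OF symmetric_central_closure[OF q] I(1)] by simp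
qed

theorem extends_involution_unique:
  "extends_involution star f \<Longrightarrow> extends_involution star g \<Longrightarrow> q \<in> central_closure \<Longrightarrow> f q = g q"
  by (simp add: extends_involution_qstar)

theorem ext_involution: "extends_involution star (ext_involution star)"
  unfolding ext_involution_def by (rule someI_ex[OF extends_involution_exists])

theorem ext_involution_centroid:
  "c \<in> extended_centroid \<Longrightarrow> ext_involution star c \<in> extended_centroid"
  using extends_involution_qstar[OF ext_involution central_closure_centroid] qstar_centroid
  by simp

end


section \<open>Orders in central simple algebras\<close>

text \<open>The unital overring is a record of HOL-Algebra, since it has to be quantified over
  existentially; \<open>e\<close> is the inclusion of \<open>R\<close>.\<close>

definition regular_element :: "'a::ring \<Rightarrow> bool" where
  "regular_element s \<longleftrightarrow> (\<forall>x. s * x = 0 \<longrightarrow> x = 0) \<and> (\<forall>x. x * s = 0 \<longrightarrow> x = 0)"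

definition rng_embedding :: "('a::ring \<Rightarrow> 'b) \<Rightarrow> ('b, 'm) ring_scheme \<Rightarrow> bool" where
  "rng_embedding e A \<longleftrightarrow> inj e \<and> range e \<subseteq> carrier A \<and>
     (\<forall>x y. e (x + y) = e x \<oplus>\<^bsub>A\<^esub> e y) \<and> (\<forall>x y. e (x * y) = e x \<otimes>\<^bsub>A\<^esub> e y)"

definition order_in :: "('a::ring \<Rightarrow> 'b) \<Rightarrow> ('b, 'm) ring_scheme \<Rightarrow> bool" where
  "order_in e A \<longleftrightarrow> Ring.ring A \<and> rng_embedding e A \<and>
     (\<forall>s. regular_element s \<longrightarrow> e s \<in> Units A) \<and>
     (\<forall>a\<in>carrier A.
        (\<exists>r s. regular_element s \<and> a = e r \<otimes>\<^bsub>A\<^esub> inv\<^bsub>A\<^esub> e s) \<and>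
        (\<exists>t u. regular_element t \<and> a = inv\<^bsub>A\<^esub> e t \<otimes>\<^bsub>A\<^esub> e u))"

definition center_of :: "('b, 'm) ring_scheme \<Rightarrow> 'b set" where
  "center_of A = {z \<in> carrier A. \<forall>x\<in>carrier A. z \<otimes>\<^bsub>A\<^esub> x = x \<otimes>\<^bsub>A\<^esub> z}"

definition simple_ring :: "('b, 'm) ring_scheme \<Rightarrow> bool" where
  "simple_ring A \<longleftrightarrow> Ring.ring A \<and> carrier A \<noteq> {\<zero>\<^bsub>A\<^esub>} \<and>
     (\<forall>I. ideal I A \<longrightarrow> I = {\<zero>\<^bsub>A\<^esub>} \<or> I = carrier A)"

text \<open>\<open>A\<close> is a central simple algebra over its center, of dimension \<open>n\<close>.\<close>

definition central_simple_of_dim :: "nat \<Rightarrow> ('b, 'm) ring_scheme \<Rightarrow> bool" where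
  "central_simple_of_dim n A \<longleftrightarrow> simple_ring A \<and> subfield (center_of A) A \<and>
     ring.dimension A n (center_of A) (carrier A)"

text \<open>The type of \<open>A\<close> is no restriction: if \<open>R\<close> is an order in a ring \<open>A\<close>, then
  \<open>a \<mapsto> {(r, s). s regular, a = r s\<^sup>-\<^sup>1}\<close> is an injection of \<open>A\<close> into the subsets of \<open>R \<times> R\<close>,
  along which \<open>A\<close> can be transported.\<close>

definition order_in_central_simple_of_dim_le :: "nat \<Rightarrow> 'a::ring itself \<Rightarrow> bool" where
  "order_in_central_simple_of_dim_le m _ \<longleftrightarrow>
     (\<exists>(A :: ('a \<times> 'a) set ring) (e :: 'a \<Rightarrow> ('a \<times> 'a) set) n.
        n \<le> m \<and> central_simple_of_dim n A \<and> order_in e A)"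

end

theory Submission
  imports Defs
begin

text \<open>Put \<open>F x = G (x\<^sup>*)\<close>. Then \<open>F\<close> is additive modulo the center and \<open>[F x, x]\<close> is central, which
  forces \<open>[F x, x] = 0\<close>. So \<open>(x, y) \<mapsto> [F x, y]\<close> is a biderivation, and hence
  \<open>F x = c x + m x\<close> with \<open>c\<close> and \<open>m x\<close> in the extended centroid \<open>C\<close>. The Jordan condition turns
  into \<open>(c - c\<^sup>2) (x \<circ> y) - 2 c (m y) x - 2 c (m x) y \<in> C\<close>. If \<open>c\<close> is idempotent, then \<open>c = 1\<close> by
  surjectivity and \<open>m = 0\<close>, so \<open>G x = x\<^sup>*\<close>. Otherwise every element is quadratic over \<open>C\<close>:
  commutators have central squares, which are not all zero, so \<open>C\<close> is the field of
  fractions of the center, and \<open>1, x, y, [x, y]\<close> is a basis of the central localization whenever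
  \<open>[x, y]\<^sup>2 \<noteq> 0\<close>.\<close>

section \<open>Characteristic, center and commutators\<close>

text \<open>From \<open>x + x = 0\<close> it follows that \<open>x * r * (y + y) = 0\<close> for all
  \<open>r\<close> and \<open>y\<close>. If \<open>x\<close> were nonzero, primeness would give
  \<open>y + y = 0\<close> for all \<open>y\<close>, and the characteristic would be exactly two,
  since one would mean a zero ring.\<close>

lemma two_torsion_free:
  fixes x :: "'a::prime_ring"
  assumes char: "rng_char TYPE('a) \<noteq> 2" and x: "x + x = 0"
  shows "x = 0"
proof (rule ccontr)
  assume "x \<noteq> 0"
  have two: "y + y = 0" for y :: 'a
  proof -
    have "x * r * (y + y) = 0" for r
      using x by (metis distrib_left distrib_right mult_zero_left mult.assoc)
    then show ?thesis using prime[of x "y + y"] \<open>x \<noteq> 0\<close> by blast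
  qed
  have "\<exists>n::nat. n > 0 \<and> (\<forall>x::'a. (\<Sum>i<n. x) = 0)"
    by (rule exI[of _ 2]) (simp add: two numeral_2_eq_2)
  moreover have "(LEAST n::nat. n > 0 \<and> (\<forall>x::'a. (\<Sum>i<n. x) = 0)) = 2"
  proof (rule Least_equality)
    show "2 \<le> n" if n: "n > 0 \<and> (\<forall>x::'a. (\<Sum>i<n. x) = 0)" for n :: nat
    proof (rule ccontr)
      assume "\<not> 2 \<le> n"
      then have "n = 1" using n by linarith
      then show False using n nonzero[where 'a = 'a] by auto
    qed
  qed (simp add: two numeral_2_eq_2)
  ultimately show False using char by (simp add: rng_char_def)
qed

lemma ring_center_commute: "z \<in> ring_center \<Longrightarrow> z * x = x * z"
  by (simp add: ring_center_def)

lemma ring_center_left_commute: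
  assumes "z \<in> ring_center"
  shows "z * (x * y) = x * (z * y)"
  by (simp only: mult.assoc[symmetric] ring_center_commute[OF assms, of x])

lemma ring_center_diff: "z \<in> ring_center \<Longrightarrow> w \<in> ring_center \<Longrightarrow> z - w \<in> ring_center"
  by (simp add: ring_center_def algebra_simps)

lemma ring_center_mult:
  assumes "z \<in> ring_center" "w \<in> ring_center"
  shows "z * w \<in> ring_center"
proof -
  have "z * w * x = x * (z * w)" for x
    by (simp only: mult.assoc ring_center_commute[OF assms(2), of x] ring_center_left_commute[OF assms(1), of x])
  then show ?thesis by (simp add: ring_center_def)
qed

lemma ring_center_cancel:
  fixes z :: "'a::prime_ring"
  assumes z: "z \<in> ring_center" "z \<noteq> 0" and "z * x = 0"
  shows "x = 0"
proof -
  have "z * r * x = 0" for r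
    using assms(3) by (simp add: ring_center_commute[OF z(1)] mult.assoc)
  then show ?thesis using prime z(2) by blast
qed

lemma commutator_add_right: "commutator z (x + y) = commutator z x + commutator z y"
  and commutator_diff_left: "commutator (x - y) z = commutator x z - commutator y z"
  and commutator_diff_right: "commutator z (x - y) = commutator z x - commutator z y"
  and commutator_mult_left: "commutator (x * y) z = x * commutator y z + commutator x z * y"
  and commutator_mult_right: "commutator z (x * y) = x * commutator z y + commutator z x * y"
  by (simp_all add: commutator_def algebra_simps)

lemma commutator_center: "z \<in> ring_center \<Longrightarrow> commutator z x = 0" "z \<in> ring_center \<Longrightarrow> commutator x z = 0"
  by (simp_all add: commutator_def ring_center_def)

section \<open>Centralizing maps, commuting maps and their biderivation\<close>

text \<open>Central elements disappear inside commutators, so the failure of \<open>F\<close> to be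
  additive is invisible to \<open>commutator (F x) w\<close>.\<close>

lemma commutator_center_additive:
  assumes "F (x + y) - F x - F y \<in> ring_center"
  shows "commutator (F (x + y)) w = commutator (F x) w + commutator (F y) w"
proof -
  have "commutator (F (x + y)) w - commutator (F x) w - commutator (F y) w = 0"
    using commutator_center(1)[OF assms, of w] by (simp only: commutator_diff_left)
  then show ?thesis by (simp add: algebra_simps)
qed

text \<open>Let \<open>z = [F x, x]\<close> and \<open>d = [F x, -]\<close>. Linearizing the
  hypothesis at \<open>x\<close> and \<open>x^2\<close> gives a central
  \<open>c = [F x, x^2] + [F (x^2), x]\<close>, and then
  \<open>[F (x^2), x^2] = 2 c x - 4 z x^2\<close>. This is central too, so \<open>d\<close> kills
  it. Applying \<open>d\<close> once more leaves \<open>8 z^3 = 0\<close>, and nonzero central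
  elements are not zero divisors.\<close>

lemma centralizing_imp_commuting:
  fixes F :: "'a::prime_ring \<Rightarrow> 'a"
  assumes two: "\<And>x :: 'a. x + x = 0 \<Longrightarrow> x = 0"
    and add: "\<And>x y. F (x + y) - F x - F y \<in> ring_center"
    and cen: "\<And>x. commutator (F x) x \<in> ring_center"
  shows "commutator (F x) x = 0"
proof -
  have lin: "commutator (F x) y + commutator (F y) x \<in> ring_center" for x y
  proof -
    have "commutator (F x) y + commutator (F y) x
        = commutator (F (x + y)) (x + y) - commutator (F x) x - commutator (F y) y"
      by (simp add: commutator_center_additive[of F, OF add] commutator_add_right)
    then show ?thesis by (simp add: cen ring_center_diff)
  qed
  define d where "d = commutator (F x)"
  define z where "z = d x"
  define c where "c = d (x * x) + commutator (F (x * x)) x"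
  have zc: "z \<in> ring_center" "c \<in> ring_center"
    unfolding z_def c_def d_def by (rule cen lin)+
  have dc: "d (y * t) = y * d t" if "y \<in> ring_center" for y t
    using that by (simp add: d_def commutator_mult_right commutator_center)
  have dadd: "d (s + t) = d s + d t" and ddiff: "d (s - t) = d s - d t" for s t
    by (simp_all add: d_def commutator_add_right commutator_diff_right)
  have dxx: "d (x * x) = z * x + z * x"
    using ring_center_commute[OF zc(1), of x] by (simp add: z_def d_def commutator_mult_right)
  have D: "commutator (F (x * x)) x = c - (z * x + z * x)"
    by (simp add: c_def dxx)
  \<comment> \<open>\<open>E\<close> is \<open>x D + D x\<close> for \<open>D = c - 2 z x\<close>,
    with the integer multiples written as sums because the ring need not have a unit.\<close>
  define E where "E = (c * x + c * x) - (z * (x * x) + z * (x * x) + (z * (x * x) + z * (x * x)))"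
  have "commutator (F (x * x)) (x * x) = E"
    using ring_center_commute[OF zc(2), of x] ring_center_left_commute[OF zc(1), of x x]
    by (simp add: commutator_mult_right D E_def algebra_simps)
  then have "E \<in> ring_center" using cen by metis
  then have E0: "d E = 0" by (simp add: d_def commutator_center)
  have zz: "z * z \<in> ring_center" by (simp add: ring_center_mult zc)
  have cz: "c * z \<in> ring_center" by (simp add: ring_center_mult zc)
  have dcz: "d (c * z) = 0" "d (c * x) = c * z" "d (z * (x * x)) = z * z * x + z * z * x"
    "d (z * z * x) = z * z * z"
    using cz by (simp_all add: d_def commutator_center)
      (simp_all add: d_def[symmetric] dc zc zz z_def[symmetric] dxx distrib_left mult.assoc)
  have "d (d E) = - (((z*z*z + z*z*z) + (z*z*z + z*z*z)) + ((z*z*z + z*z*z) + (z*z*z + z*z*z)))"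
    by (simp add: E_def dadd ddiff dcz dcz[unfolded mult.assoc] algebra_simps)
  then have "((z*z*z + z*z*z) + (z*z*z + z*z*z)) + ((z*z*z + z*z*z) + (z*z*z + z*z*z)) = 0"
    using E0 by (simp only: d_def commutator_def mult_zero_left mult_zero_right diff_zero neg_0_equal_iff_equal)
  then have "z * z * z = 0" using two[of "z*z*z"] two[of "z*z*z + z*z*z"] two[of "(z*z*z + z*z*z) + (z*z*z + z*z*z)"] by blast
  then have "z = 0" using ring_center_cancel[OF zc(1)] by (metis mult.assoc)
  then show ?thesis by (simp add: z_def d_def)
qed

text \<open>Expanding \<open>B (x z) (y w)\<close> for \<open>B x y = [F x, y] = [x, F y]\<close> in both orders.\<close>

lemma commuting_biderivation:
  fixes F :: "'a::ring \<Rightarrow> 'a"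
  assumes add: "\<And>x y. F (x + y) - F x - F y \<in> ring_center"
    and com: "\<And>x. commutator (F x) x = 0"
  shows "commutator (F x) y * r * commutator z w = commutator x y * r * commutator (F z) w"
proof -
  \<comment> \<open>Linearizing \<open>[F x, x] = 0\<close> makes the map a derivation in its first
    argument as well, although \<open>F\<close> itself is not one.\<close>
  have sym: "commutator (F x) y = commutator x (F y)" for x y
  proof -
    have "0 = commutator (F (x + y)) (x + y)" by (simp add: com)
    also have "\<dots> = commutator (F x) y + commutator (F y) x"
      by (simp only: commutator_center_additive[of F, OF add] commutator_add_right com) simp
    finally show ?thesis by (simp add: commutator_def algebra_simps)
  qed
  define B where "B x y = commutator (F x) y" for x y
  have Bl: "B (x * u) y = x * B u y + B x y * u" for x u y
    by (simp add: B_def sym commutator_mult_left)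
  have Br: "B x (y * v) = y * B x v + B x y * v" for x y v
    by (simp add: B_def commutator_mult_right)
  have *: "B x y * commutator z w = commutator x y * B z w" for x y z w
  proof -
    have 1: "B (x * z) (y * w) = y * (x * B z w + B x w * z) + (x * B z y + B x y * z) * w"
      using Br[of "x * z" y w] by (simp only: Bl[of x z y] Bl[of x z w])
    have 2: "B (x * z) (y * w) = x * (y * B z w + B z y * w) + (y * B x w + B x y * w) * z"
      using Bl[of x z "y * w"] by (simp only: Br)
    from 1 2 show ?thesis by (simp add: commutator_def algebra_simps)
  qed
  \<comment> \<open>Replacing \<open>z\<close> by \<open>r * z\<close> and cancelling the terms
    already equal by \<open>*\<close> moves an arbitrary \<open>r\<close> between the two
    factors.\<close>
  have "B x y * commutator (r * z) w = commutator x y * B (r * z) w" by (rule *)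
  then have "B x y * r * commutator z w + B x y * commutator r w * z
      = commutator x y * r * B z w + commutator x y * B r w * z"
    by (simp add: Bl commutator_mult_left distrib_left mult.assoc)
  then show ?thesis by (simp add: *) (simp add: B_def)
qed

section \<open>The extended centroid as a field, and the form of commuting maps\<close>

lemma extended_centroid_minus: "c \<in> extended_centroid \<Longrightarrow> d \<in> extended_centroid \<Longrightarrow> c - d \<in> extended_centroid"
  and extended_centroid_uminus: "c \<in> extended_centroid \<Longrightarrow> - c \<in> extended_centroid"
  and extended_centroid_zero: "0 \<in> extended_centroid"
  and extended_centroid_one: "1 \<in> extended_centroid"
  by (simp_all add: extended_centroid_def ring_center_def algebra_simps)

lemmas extended_centroid_closed = extended_centroid_add extended_centroid_minus
  extended_centroid_uminus extended_centroid_mult extended_centroid_zero extended_centroid_one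

lemma qmr_of_extended_centroid: "qmr_of z \<in> extended_centroid \<longleftrightarrow> z \<in> ring_center"
proof
  assume "qmr_of z \<in> extended_centroid"
  then show "z \<in> ring_center"
    using extended_centroid_commute[of "qmr_of z" "qmr_of x" for x]
    by (simp add: ring_center_def qmr_of_mult[symmetric] qmr_of_inject)
next
  assume "z \<in> ring_center"
  then show "qmr_of z \<in> extended_centroid"
    unfolding extended_centroid_def
    by (intro ring_center_qmrI) (simp add: qmr_of_mult[symmetric] ring_center_def)
qed

text \<open>Primeness carried over to a right factor from the ring of quotients: a dense right ideal
  moves \<open>q\<close> into the ring, where \<open>prime\<close> kills the resulting values of
  \<open>q\<close>.\<close>

lemma qmr_prime:
  assumes "\<And>r. qmr_of a * qmr_of r * q = 0" "a \<noteq> 0"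
  shows "q = 0"
proof -
  obtain J where J: "dense_right_ideal J" "\<And>x. x \<in> J \<Longrightarrow> \<exists>y. q * qmr_of x = qmr_of y"
    using qmr_denominator by blast
  show ?thesis
  proof (rule qmr_annihilator[OF J(1)])
    fix x assume "x \<in> J"
    then obtain y where y: "q * qmr_of x = qmr_of y" using J(2) by blast
    have "a * r * y = 0" for r
    proof -
      have "qmr_of (a * r * y) = qmr_of a * qmr_of r * q * qmr_of x"
        by (simp add: qmr_of_mult y mult.assoc)
      also have "\<dots> = 0" by (simp add: assms(1))
      finally show ?thesis by (rule qmr_of_eq_0)
    qed
    then have "y = 0" using prime assms(2) by blast
    then show "q * qmr_of x = 0" by (simp add: y qmr_of_zero)
  qed
qed

text \<open>The quotient \<open>b / a\<close> is the endomorphism \<open>\<Sum> r a s \<mapsto> \<Sum> r b s\<close> of the ideal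
  generated by \<open>a\<close>; the ideal below contains the latter and makes it obviously well defined.\<close>

lemma extended_centroid_quotient:
  fixes a b :: "'a::prime_ring"
  assumes a: "a \<noteq> 0" and ab: "\<And>t. a * t * b = b * t * a"
  shows "\<exists>c\<in>extended_centroid. qmr_of b = c * qmr_of a"
proof -
  define P where "P x y \<longleftrightarrow> (\<forall>t. x * t * b = y * t * a)" for x y
  define I where "I = {x. \<exists>y. P x y}"
  define f where "f x = (SOME y. P x y)" for x
  have f: "P x (f x)" if "x \<in> I" for x
    using that unfolding I_def f_def by (blast intro: someI)
  have uniq: "y = y'" if "P x y" "P x y'" for x y y'
  proof -
    have "(y - y') * t * a = 0" for t
      using that unfolding P_def by (metis left_diff_distrib right_minus_eq)
    then show ?thesis using prime a by fastforce
  qed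
  have f_eq: "f x = y" if "P x y" for x y
    using that f uniq unfolding I_def by blast
  have Padd: "P (x + x') (y + y')" and Pdiff: "P (x - x') (y - y')" if "P x y" "P x' y'" for x x' y y'
    using that by (simp_all add: P_def distrib_right left_diff_distrib)
  have Pr: "P (x * r) (y * r)" and Pl: "P (r * x) (r * y)" if "P x y" for x y r
  proof -
    show "P (x * r) (y * r)" unfolding P_def
    proof
      fix t
      have "x * (r * t) * b = y * (r * t) * a" using that unfolding P_def by blast
      then show "x * r * t * b = y * r * t * a" by (simp add: mult.assoc)
    qed
    show "P (r * x) (r * y)" using that by (simp add: P_def mult.assoc)
  qed
  have Pab: "P a b" by (simp add: P_def ab)
  have I: "dense_ideal I"
  proof (rule dense_idealI)
    have "P 0 0" by (simp add: P_def)
    then show "right_ideal I"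
      unfolding right_ideal_def I_def by (auto intro: Pdiff Pr)
    show "r * x \<in> I" if "x \<in> I" for x r using that Pl by (auto simp: I_def)
    show "a \<in> I" using Pab by (auto simp: I_def)
  qed (rule a)
  have hom: "right_hom_on I f"
    by (simp add: right_hom_on_def f_eq[OF Padd[OF f f]] f_eq[OF Pr[OF f]])
  have "dense_right_ideal I" using I by (simp add: dense_ideal_def)
  then obtain c where c: "\<forall>x\<in>I. c * qmr_of x = qmr_of (f x)"
    using qmr_complete[OF _ hom] by blast
  \<comment> \<open>The ideal \<open>I\<close> is two-sided and \<open>f\<close> is also left
    linear, by \<open>Pl\<close>; this is what makes the right homomorphism central.\<close>
  have "c \<in> ring_center"
  proof (rule ring_center_qmrI)
    fix r
    show "c * qmr_of r = qmr_of r * c"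
    proof (rule qmr_annihilator_eq[OF \<open>dense_right_ideal I\<close>])
      fix x assume x: "x \<in> I"
      then have "r * x \<in> I" using I by (simp add: dense_ideal_def)
      then have "c * qmr_of (r * x) = qmr_of (r * f x)" using c f_eq[OF Pl[OF f[OF x]]] by simp
      then show "c * qmr_of r * qmr_of x = qmr_of r * c * qmr_of x"
        using c x by (simp add: qmr_of_mult mult.assoc)
    qed
  qed
  moreover have "c * qmr_of a = qmr_of b" using c Pab f_eq by (auto simp: I_def)
  ultimately show ?thesis unfolding extended_centroid_def by metis
qed

text \<open>For a noncommuting pair \<open>x\<close>, \<open>y\<close>, the elements
  \<open>[x, y]\<close> and \<open>[F x, y]\<close> satisfy the hypothesis of
  \<open>extended_centroid_quotient\<close>, which yields \<open>c\<close>. The biderivation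
  identity then reads \<open>[x, y] r (c [z, w] - [F z, w]) = 0\<close>, so \<open>F z - c z\<close>
  commutes with every \<open>w\<close>.\<close>

theorem commuting_map_form:
  fixes F :: "'a::prime_ring \<Rightarrow> 'a"
  assumes noncomm: "\<exists>x y :: 'a. x * y \<noteq> y * x"
    and add: "\<And>x y. F (x + y) - F x - F y \<in> ring_center"
    and com: "\<And>x. commutator (F x) x = 0"
  shows "\<exists>c\<in>extended_centroid. \<forall>x. qmr_of (F x) - c * qmr_of x \<in> extended_centroid"
proof -
  note bi = commuting_biderivation[of F, OF add com]
  obtain x y :: 'a where xy: "commutator x y \<noteq> 0"
    using noncomm by (auto simp: commutator_def)
  obtain c where c: "c \<in> extended_centroid" "qmr_of (commutator (F x) y) = c * qmr_of (commutator x y)"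
    using extended_centroid_quotient[of "commutator x y" "commutator (F x) y"] xy bi by metis
  have "qmr_of (F z) - c * qmr_of z \<in> extended_centroid" for z
    unfolding extended_centroid_def
  proof (rule ring_center_qmrI)
    fix w
    have "c * qmr_of (commutator z w) - qmr_of (commutator (F z) w) = 0"
    proof (rule qmr_prime[OF _ xy])
      fix r
      have "qmr_of (commutator x y) * qmr_of r * (c * qmr_of (commutator z w))
          = qmr_of (commutator (F x) y * r * commutator z w)"
        by (simp add: qmr_of_mult c(2) extended_centroid_left_commute[OF c(1)] mult.assoc)
      then show "qmr_of (commutator x y) * qmr_of r *
          (c * qmr_of (commutator z w) - qmr_of (commutator (F z) w)) = 0"
        by (simp add: bi qmr_of_mult right_diff_distrib)
    qed
    then show "(qmr_of (F z) - c * qmr_of z) * qmr_of w = qmr_of w * (qmr_of (F z) - c * qmr_of z)"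
      by (simp add: commutator_def qmr_of_diff qmr_of_mult algebra_simps
          extended_centroid_left_commute[OF c(1), of "qmr_of w"])
  qed
  then show ?thesis using c(1) by blast
qed

text \<open>Some ring element \<open>i\<close> has \<open>c i = r\<close> with \<open>r\<close> a
  nonzero ring element. Since \<open>c\<close> is central, \<open>r s q = i s (c q) = 0\<close> for
  all \<open>s\<close>, and \<open>qmr_prime\<close> applies.\<close>

lemma extended_centroid_cancel:
  fixes c :: "'a::prime_ring qmr"
  assumes c: "c \<in> extended_centroid" "c \<noteq> 0" and "c * q = 0"
  shows "q = 0"
proof -
  obtain I where I: "dense_ideal I" "\<And>i. i \<in> I \<Longrightarrow> \<exists>r. c * qmr_of i = qmr_of r"
    using symmetric_centroid[OF c(1)] unfolding symmetric_def by blast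
  then obtain i where "i \<in> I" "c * qmr_of i \<noteq> 0"
    using qmr_annihilator[of I c] c(2) unfolding dense_ideal_def by blast
  then obtain r where r: "c * qmr_of i = qmr_of r" "r \<noteq> 0"
    using I(2) by (metis qmr_of_zero)
  have "qmr_of r * qmr_of s * q = 0" for s
  proof -
    have "qmr_of r * qmr_of s * q = qmr_of i * (qmr_of s * (c * q))"
      by (simp only: r(1)[symmetric] mult.assoc extended_centroid_left_commute[OF c(1)])
    then show ?thesis by (simp add: assms(3))
  qed
  then show ?thesis by (rule qmr_prime[OF _ r(2)])
qed

text \<open>Division by \<open>c\<close> is well defined and linear on the ideal \<open>K\<close> of
  those ring elements that are \<open>c\<close> times a ring element. It is represented by some
  \<open>d\<close>, which is inverse to \<open>c\<close> and therefore central.\<close>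

lemma extended_centroid_inverse:
  fixes c :: "'a::prime_ring qmr"
  assumes c: "c \<in> extended_centroid" "c \<noteq> 0"
  obtains d where "d \<in> extended_centroid" "c * d = 1" "d * c = 1"
proof -
  obtain I where I: "dense_ideal I" "\<And>i. i \<in> I \<Longrightarrow> \<exists>r. c * qmr_of i = qmr_of r"
    using symmetric_centroid[OF c(1)] unfolding symmetric_def by blast
  define P where "P r i \<longleftrightarrow> qmr_of r = c * qmr_of i" for r i
  define K where "K = {r. \<exists>i. P r i}"
  define f where "f r = (SOME i. P r i)" for r
  have f: "P r (f r)" if "r \<in> K" for r
    using that unfolding K_def f_def by (blast intro: someI)
  have uniq: "i = j" if "P r i" "P r j" for r i j
  proof -
    have "c * qmr_of (i - j) = 0" using that by (simp add: P_def qmr_of_diff right_diff_distrib)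
    then have "qmr_of (i - j) = 0" by (rule extended_centroid_cancel[OF c])
    then show ?thesis using qmr_of_eq_0 by fastforce
  qed
  have f_eq: "f r = i" if "P r i" for r i
    using uniq[OF f that] that by (auto simp: K_def)
  have Padd: "P (x + x') (y + y')" and Pdiff: "P (x - x') (y - y')" if "P x y" "P x' y'" for x x' y y'
    using that by (simp_all add: P_def qmr_of_add qmr_of_diff distrib_left right_diff_distrib)
  have Pr: "P (x * r) (y * r)" and Pl: "P (r * x) (r * y)" if "P x y" for x y r
    using that by (simp_all add: P_def qmr_of_mult mult.assoc extended_centroid_left_commute[OF c(1), of "qmr_of r"])
  obtain i r where ir: "P r i" "r \<noteq> 0"
  proof -
    have "\<exists>i\<in>I. c * qmr_of i \<noteq> 0"
      using qmr_annihilator[of I c] I(1) c(2) unfolding dense_ideal_def by blast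
    then show thesis using I(2) that unfolding P_def by (metis qmr_of_zero)
  qed
  have K: "dense_ideal K"
  proof (rule dense_idealI)
    have "P 0 0" by (simp add: P_def qmr_of_zero)
    then show "right_ideal K"
      unfolding right_ideal_def K_def by (auto intro: Pdiff Pr)
    show "r * x \<in> K" if "x \<in> K" for x r using that Pl by (auto simp: K_def)
    show "r \<in> K" using ir(1) by (auto simp: K_def)
  qed (rule ir(2))
  have "right_hom_on K f"
    by (simp add: right_hom_on_def f_eq[OF Padd[OF f f]] f_eq[OF Pr[OF f]])
  then obtain d where d: "\<forall>x\<in>K. d * qmr_of x = qmr_of (f x)"
    using qmr_complete K unfolding dense_ideal_def by blast
  have dc: "d * c = 1"
  proof (rule qmr_annihilator_eq)
    show "dense_right_ideal I" using I(1) by (simp add: dense_ideal_def)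
    fix x assume "x \<in> I"
    then obtain y where "P y x" using I(2) unfolding P_def by metis
    then have "d * qmr_of y = qmr_of x" "qmr_of y = c * qmr_of x"
      using d f_eq by (auto simp: K_def P_def)
    then show "d * c * qmr_of x = 1 * qmr_of x" by (simp add: mult.assoc)
  qed
  then have cd: "c * d = 1" by (simp add: extended_centroid_commute[OF c(1)])
  have "d * q = q * d" for q
  proof -
    have "d * q = d * q * (c * d)" by (simp add: cd)
    also have "\<dots> = d * c * (q * d)"
      by (simp only: mult.assoc extended_centroid_left_commute[OF c(1), of q])
    finally show ?thesis by (simp add: dc)
  qed
  then have "d \<in> extended_centroid" by (simp add: extended_centroid_def ring_center_def)
  then show thesis using that cd dc by blast
qed

lemma qmr_two_torsion_free:
  fixes q :: "'a::prime_ring qmr"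
  assumes two: "\<And>x :: 'a. x + x = 0 \<Longrightarrow> x = 0" and q: "q + q = 0"
  shows "q = 0"
proof -
  obtain J where J: "dense_right_ideal J" "\<And>x. x \<in> J \<Longrightarrow> \<exists>y. q * qmr_of x = qmr_of y"
    using qmr_denominator by blast
  show ?thesis
  proof (rule qmr_annihilator[OF J(1)])
    fix x assume "x \<in> J"
    then obtain y where y: "q * qmr_of x = qmr_of y" using J(2) by blast
    have "qmr_of (y + y) = (q + q) * qmr_of x" by (simp add: y qmr_of_add distrib_right)
    then have "y + y = 0" using q by (simp add: qmr_of_eq_0)
    then have "y = 0" by (rule two)
    then show "q * qmr_of x = 0" by (simp add: y qmr_of_zero)
  qed
qed

lemma extended_centroid_half:
  fixes q :: "'a::prime_ring qmr"
  assumes two: "\<And>x :: 'a. x + x = 0 \<Longrightarrow> x = 0" and q: "q + q \<in> extended_centroid"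
  shows "q \<in> extended_centroid"
proof -
  have "q * p - p * q = 0" for p
  proof (rule qmr_two_torsion_free[OF two])
    have "(q + q) * p = p * (q + q)" by (rule extended_centroid_commute[OF q])
    then show "q * p - p * q + (q * p - p * q) = 0" by (simp add: algebra_simps)
  qed
  then show ?thesis by (simp add: extended_centroid_def ring_center_def)
qed

section \<open>Prime rings whose elements are quadratic over the extended centroid\<close>

text \<open>Suppose that \<open>I\<close> is commutative and \<open>a\<close> is a nonzero element
  of it. Then \<open>a s [x, r] = 0\<close> for \<open>x\<close> in \<open>I\<close>, so
  \<open>I\<close> is central. Now \<open>a s\<close> and \<open>a s r\<close> are central, whence
  \<open>a s [r, t] = 0\<close>, and the whole ring would be commutative.\<close>

lemma noncommutative_dense_ideal:
  fixes I :: "'a::prime_ring set"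
  assumes noncomm: "\<exists>x y :: 'a. x * y \<noteq> y * x" and I: "dense_ideal I"
  shows "\<exists>x\<in>I. \<exists>y\<in>I. commutator x y \<noteq> 0"
proof (rule ccontr)
  assume "\<not> ?thesis"
  then have 0: "\<And>x y. x \<in> I \<Longrightarrow> y \<in> I \<Longrightarrow> commutator x y = 0" by blast
  obtain a where a: "a \<in> I" "a \<noteq> 0" using dense_ideal_nonzero[OF I] .
  have Ir: "x * r \<in> I" if "x \<in> I" for x r
    using I that dense_closed(5) unfolding dense_ideal_def by blast
  have "commutator x r = 0" if x: "x \<in> I" for x r
  proof -
    have "a * s * commutator x r = 0" for s
      using 0[OF x Ir[OF Ir[OF a(1)]], of s r] 0[OF x Ir[OF a(1)], of s]
      by (simp add: commutator_mult_right)
    then show ?thesis using prime a(2) by blast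
  qed
  then have "a * s * commutator r t = 0" for s r t :: 'a
    using Ir[OF a(1)] commutator_mult_left[of "a * s" r t] by (metis Ir add.right_neutral mult_zero_left)
  then have "commutator r t = 0" for r t :: 'a using prime[of a "commutator r t"] a(2) by blast
  then show False using noncomm by (simp add: commutator_def)
qed

text \<open>In the last identity, \<open>c\<^sup>2 - 4 a b\<close> is the discriminant of the quaternion algebra generated
  by \<open>p\<close> and \<open>q\<close>, for \<open>a = p\<^sup>2\<close>, \<open>b = q\<^sup>2\<close>, \<open>c = p \<circ> q\<close>.\<close>

lemma quaternion_relations:
  fixes p q :: "'a::ring_1"
  assumes a: "p * p \<in> ring_center" and b: "q * q \<in> ring_center" and c: "p * q + q * p \<in> ring_center"
  shows "(p * q - q * p) * p = - (p * (p * q - q * p))"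
    and "(p * q - q * p) * q = - (q * (p * q - q * p))"
    and "(p * q - q * p) * (p * q - q * p) = (p * q + q * p) * (p * q + q * p)
      - (p * p * (q * q) + p * p * (q * q) + p * p * (q * q) + p * p * (q * q))"
proof -
  show "(p * q - q * p) * p = - (p * (p * q - q * p))"
    using ring_center_commute[OF a, of q] by (simp add: algebra_simps)
  show "(p * q - q * p) * q = - (q * (p * q - q * p))"
    using ring_center_commute[OF b, of p] by (simp add: algebra_simps)
  have "q * p * (p * q) = p * p * (q * q)" "p * q * (q * p) = p * p * (q * q)"
    using ring_center_commute[OF a, of q] ring_center_commute[OF a, of "q * q"]
      ring_center_commute[OF b, of p]
    by (metis mult.assoc)+
  then show "(p * q - q * p) * (p * q - q * p) = (p * q + q * p) * (p * q + q * p)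
      - (p * p * (q * q) + p * p * (q * q) + p * p * (q * q) + p * p * (q * q))"
    by (simp add: algebra_simps)
qed

text \<open>The element \<open>v x\<close> is the trace-zero part \<open>x - t(x) / 2\<close> of \<open>x\<close>.\<close>

locale quadratic_prime_ring =
  fixes v :: "'a::prime_ring \<Rightarrow> 'a qmr"
  assumes two: "\<And>x :: 'a. x + x = 0 \<Longrightarrow> x = 0"
    and noncomm: "\<exists>x y :: 'a. x * y \<noteq> y * x"
    and v_diff: "\<And>x. qmr_of x - v x \<in> extended_centroid"
    and v_anticomm: "\<And>x y. v x * v y + v y * v x \<in> extended_centroid"
begin

lemma half: "q + q \<in> extended_centroid \<Longrightarrow> q \<in> extended_centroid" for q :: "'a qmr"
  by (rule extended_centroid_half[OF two])

lemma v_square: "v x * v x \<in> extended_centroid"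
  by (rule half[OF v_anticomm])

lemma qmr_of_v: "\<exists>s\<in>extended_centroid. qmr_of x = v x + s"
  using v_diff[of x] by (intro bexI[of _ "qmr_of x - v x"]) auto

lemma qmr_of_commutator: "qmr_of (commutator x y) = v x * v y - v y * v x"
proof -
  obtain s where s: "s \<in> extended_centroid" "qmr_of x = v x + s" using qmr_of_v by blast
  obtain t where t: "t \<in> extended_centroid" "qmr_of y = v y + t" using qmr_of_v by blast
  show ?thesis
    by (simp add: commutator_def qmr_of_diff qmr_of_mult s(2) t(2) algebra_simps
        extended_centroid_commute[OF s(1), of "v y"] extended_centroid_commute[OF t(1), of "v x"]
        extended_centroid_commute[OF t(1), of s])
qed

lemmas v_center = v_square[unfolded extended_centroid_def] v_anticomm[unfolded extended_centroid_def]

lemma commutator_anticomm: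
  "qmr_of (commutator x y) * v x = - (v x * qmr_of (commutator x y))"
  "qmr_of (commutator x y) * v y = - (v y * qmr_of (commutator x y))"
  unfolding qmr_of_commutator by (rule quaternion_relations(1,2)[OF v_center(1) v_center(1) v_center(2)])+

lemma commutator_square_qmr:
  "qmr_of (commutator x y) * qmr_of (commutator x y)
    = (v x * v y + v y * v x) * (v x * v y + v y * v x)
      - (v x * v x * (v y * v y) + v x * v x * (v y * v y) + v x * v x * (v y * v y) + v x * v x * (v y * v y))"
  unfolding qmr_of_commutator by (rule quaternion_relations(3)[OF v_center(1) v_center(1) v_center(2)])

lemma commutator_square_center: "commutator x y * commutator x y \<in> ring_center" for x y :: 'a
proof -
  have "qmr_of (commutator x y * commutator x y) \<in> extended_centroid"
    unfolding qmr_of_mult commutator_square_qmr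
    by (intro extended_centroid_closed v_square v_anticomm)
  then show ?thesis by (simp only: qmr_of_extended_centroid)
qed

lemma v_noncentral:
  assumes "commutator x y \<noteq> 0"
  shows "v x \<notin> extended_centroid"
proof
  assume "v x \<in> extended_centroid"
  then have "qmr_of (commutator x y) = 0"
    by (simp add: qmr_of_commutator extended_centroid_commute[of "v x" "v y"])
  then show False using assms qmr_of_eq_0 by blast
qed

text \<open>Commutators have trace zero. Write \<open>v u = u - s\<close> for
  \<open>u = [x, y]\<close>. As \<open>u\<close> anticommutes with \<open>v x\<close>, the
  anticommutator of \<open>v x\<close> and \<open>v u\<close> is \<open>- 2 s (v x)\<close>. It lies
  in the extended centroid while \<open>v x\<close> does not, so \<open>s = 0\<close>.\<close>

lemma v_commutator:
  assumes nz: "commutator x y \<noteq> 0"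
  shows "v (commutator x y) = qmr_of (commutator x y)"
proof -
  let ?u = "commutator x y"
  obtain s where s: "s \<in> extended_centroid" "qmr_of ?u = v ?u + s" using qmr_of_v by blast
  have vu: "v ?u = qmr_of ?u - s" by (simp add: s(2))
  have "v x * v ?u + v ?u * v x = - (s * v x + s * v x)"
    unfolding vu by (simp add: algebra_simps commutator_anticomm extended_centroid_commute[OF s(1), of "v x"])
  then have "s * v x + s * v x \<in> extended_centroid"
    using v_anticomm[of x ?u] extended_centroid_uminus by fastforce
  then have sx: "s * v x \<in> extended_centroid" by (rule half)
  have "s = 0"
  proof (rule ccontr)
    assume "s \<noteq> 0"
    then obtain t where "t \<in> extended_centroid" "t * s = 1" using extended_centroid_inverse[OF s(1)] by metis
    then have "v x \<in> extended_centroid"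
      using extended_centroid_mult[OF _ sx, of t] by (simp add: mult.assoc[symmetric])
    then show False using v_noncentral[OF nz] by blast
  qed
  then show ?thesis using s(2) by simp
qed


text \<open>If \<open>u = [x, y] \<noteq> 0\<close> has square \<open>0\<close>, then \<open>[u, r]\<^sup>2 = (u \<circ> v r)\<^sup>2\<close>, and \<open>u \<circ> v r = 0\<close> would give
  \<open>u r u = 0\<close>.\<close>

lemma dense_ideal_commutator_square:
  fixes I :: "'a set"
  assumes I: "dense_ideal I"
  shows "\<exists>x\<in>I. \<exists>y\<in>I. commutator x y * commutator x y \<noteq> 0"
proof (rule ccontr)
  assume "\<not> ?thesis"
  then have 0: "\<And>x y. x \<in> I \<Longrightarrow> y \<in> I \<Longrightarrow> commutator x y * commutator x y = 0" by blast
  obtain x y where xy: "x \<in> I" "y \<in> I" "commutator x y \<noteq> 0"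
    using noncommutative_dense_ideal[OF noncomm I] by blast
  define u where "u = commutator x y"
  have uI: "u \<in> I"
    using xy I dense_closed[of I] by (simp add: u_def commutator_def dense_ideal_def)
  have uu: "u * u = 0" using 0[OF xy(1,2)] by (simp add: u_def)
  have vu: "v u = qmr_of u" unfolding u_def by (rule v_commutator[OF xy(3)])
  have vuu: "v u * v u = 0" by (simp add: vu qmr_of_mult[symmetric] uu qmr_of_zero)
  have uru: "u * r * u = 0" if r: "r \<in> I" for r
  proof -
    define g where "g = v u * v r + v r * v u"
    have "g * g = qmr_of (commutator u r * commutator u r)"
      using commutator_square_qmr[of u r] by (simp add: qmr_of_mult vuu g_def)
    then have gg: "g * g = 0" using 0[OF uI r] by (simp add: qmr_of_zero)
    have "g = 0"
      using extended_centroid_cancel[OF v_anticomm[of u r], of g] gg unfolding g_def by blast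
    obtain s where s: "s \<in> extended_centroid" "qmr_of r = v r + s" using qmr_of_v by blast
    have "v u * v r * v u = (g - v r * v u) * v u" by (simp add: g_def)
    then have vr: "v u * v r * v u = 0" by (simp add: \<open>g = 0\<close> mult.assoc vuu)
    have "v u * s * v u = 0"
      by (simp add: extended_centroid_commute[OF s(1), symmetric] mult.assoc vuu)
    then have "qmr_of (u * r * u) = 0"
      by (simp add: qmr_of_mult s(2) vu[symmetric] distrib_left distrib_right vr)
    then show ?thesis by (rule qmr_of_eq_0)
  qed
  have u0: "u \<noteq> 0" using xy(3) by (simp add: u_def)
  \<comment> \<open>Since \<open>I\<close> is a left ideal, \<open>u (s r) u = 0\<close> for every
    \<open>s\<close>, and primeness gives \<open>r u = 0\<close>.\<close>
  have ru: "r * u = 0" if r: "r \<in> I" for r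
  proof -
    have "u * s * (r * u) = 0" for s
    proof -
      have "s * r \<in> I" using r I by (simp add: dense_ideal_def)
      from uru[OF this] show ?thesis by (simp add: mult.assoc)
    qed
    then show ?thesis using prime[of u "r * u"] u0 by blast
  qed
  have "qmr_of u = 0"
    by (rule dense_ideal_left_annihilator[OF I]) (simp add: qmr_of_mult[symmetric] qmr_of_zero ru)
  then show False using u0 qmr_of_eq_0 by blast
qed

text \<open>Squares of commutators from \<open>I\<close> are central, lie in \<open>I\<close> and do
  not all vanish. This is what makes central denominators sufficient below.\<close>

lemma dense_ideal_center:
  fixes I :: "'a set"
  assumes I: "dense_ideal I"
  shows "\<exists>z\<in>I. z \<in> ring_center \<and> z \<noteq> 0"
proof -
  obtain x y where xy: "x \<in> I" "y \<in> I" "commutator x y * commutator x y \<noteq> 0"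
    using dense_ideal_commutator_square[OF I] by blast
  have "commutator x y * commutator x y \<in> I"
    using xy I dense_closed[of I] by (simp add: commutator_def dense_ideal_def)
  then show ?thesis using xy(3) commutator_square_center by blast
qed

section \<open>The central localization\<close>

text \<open>Realized inside \<open>'a qmr\<close> rather than by classes of fractions, so that the
  ring laws are inherited.\<close>

definition central_localization :: "'a qmr set" where
  "central_localization = {q. \<exists>z\<in>ring_center. z \<noteq> 0 \<and> (\<exists>r. q * qmr_of z = qmr_of r)}"

lemma localizationI:
  "z \<in> ring_center \<Longrightarrow> z \<noteq> 0 \<Longrightarrow> q * qmr_of z = qmr_of r \<Longrightarrow> q \<in> central_localization"
  unfolding central_localization_def by blast

lemma localizationE:
  assumes "q \<in> central_localization"
  obtains z r where "z \<in> ring_center" "z \<noteq> 0" "q * qmr_of z = qmr_of r"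
  using assms unfolding central_localization_def by blast

lemma qmr_of_localization: "qmr_of r \<in> central_localization"
proof -
  obtain z :: 'a where "z \<in> ring_center" "z \<noteq> 0"
    using dense_ideal_center[OF dense_ideal_UNIV] by blast
  then show ?thesis by (rule localizationI) (simp add: qmr_of_mult[symmetric] qmr_of_inject)
qed

text \<open>The dense ideal that \<open>c\<close> multiplies into the ring contains a nonzero
  central element, which serves as a denominator of \<open>c\<close>.\<close>

lemma extended_centroid_localization:
  assumes c: "c \<in> extended_centroid"
  shows "c \<in> central_localization"
proof -
  obtain I where I: "dense_ideal I" "\<And>i. i \<in> I \<Longrightarrow> \<exists>r. c * qmr_of i = qmr_of r"
    using symmetric_centroid[OF c(1)] unfolding symmetric_def by blast
  obtain z where "z \<in> I" "z \<in> ring_center" "z \<noteq> 0" using dense_ideal_center[OF I(1)] by blast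
  then show ?thesis using I(2) localizationI by blast
qed

lemma localization_common_denominator:
  assumes "p \<in> central_localization" "q \<in> central_localization"
  obtains z r s where "z \<in> ring_center" "z \<noteq> 0" "p * qmr_of z = qmr_of r" "q * qmr_of z = qmr_of s"
proof -
  obtain y r where y: "y \<in> ring_center" "y \<noteq> 0" "p * qmr_of y = qmr_of r"
    using localizationE[OF assms(1)] .
  obtain z s where z: "z \<in> ring_center" "z \<noteq> 0" "q * qmr_of z = qmr_of s"
    using localizationE[OF assms(2)] .
  show thesis
  proof (rule that)
    show "y * z \<in> ring_center" using y z by (simp add: ring_center_mult)
    show "y * z \<noteq> 0" using ring_center_cancel[OF y(1,2)] z(2) by blast
    show "p * qmr_of (y * z) = qmr_of (r * z)"
      by (simp add: qmr_of_mult mult.assoc[symmetric] y(3))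
    show "q * qmr_of (y * z) = qmr_of (s * y)"
      by (simp add: ring_center_commute[OF y(1)] qmr_of_mult mult.assoc[symmetric] z(3))
  qed
qed

lemma localization_add:
  assumes "p \<in> central_localization" "q \<in> central_localization"
  shows "p + q \<in> central_localization"
proof -
  obtain z r s where "z \<in> ring_center" "z \<noteq> 0" "p * qmr_of z = qmr_of r" "q * qmr_of z = qmr_of s"
    using localization_common_denominator[OF assms] .
  then show ?thesis
    by (intro localizationI[of z _ "r + s"]) (simp_all add: qmr_of_add distrib_right)
qed

lemma localization_mult:
  assumes "p \<in> central_localization" "q \<in> central_localization"
  shows "p * q \<in> central_localization"
proof -
  obtain z r s where z: "z \<in> ring_center" "z \<noteq> 0" "p * qmr_of z = qmr_of r" "q * qmr_of z = qmr_of s"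
    using localization_common_denominator[OF assms] .
  have "qmr_of z \<in> extended_centroid" using z(1) by (simp add: qmr_of_extended_centroid)
  then have "p * q * qmr_of (z * z) = p * qmr_of z * (q * qmr_of z)"
    by (simp add: qmr_of_mult mult.assoc extended_centroid_left_commute)
  then have "p * q * qmr_of (z * z) = qmr_of (r * s)" by (simp only: z(3,4) qmr_of_mult)
  moreover have "z * z \<in> ring_center" "z * z \<noteq> 0"
    using z ring_center_mult ring_center_cancel by blast+
  ultimately show ?thesis by (intro localizationI)
qed

lemma localization_uminus:
  assumes "p \<in> central_localization"
  shows "- p \<in> central_localization"
  using localization_mult[OF extended_centroid_localization assms, of "- 1"]
  by (simp add: extended_centroid_uminus extended_centroid_one)

lemma localization_minus:
  "p \<in> central_localization \<Longrightarrow> q \<in> central_localization \<Longrightarrow> p - q \<in> central_localization"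
  using localization_add[OF _ localization_uminus, of p q] by simp

lemma localization_central:
  assumes "c \<in> central_localization" and "\<And>q. q \<in> central_localization \<Longrightarrow> c * q = q * c"
  shows "c \<in> extended_centroid"
  unfolding extended_centroid_def by (intro ring_center_qmrI assms(2) qmr_of_localization)

text \<open>With \<open>t\<close> half the trace of \<open>s\<close>, the element
  \<open>w = s - 2 t\<close> is minus the conjugate of \<open>s\<close>, and
  \<open>m = s w = w s\<close> is minus the norm. If \<open>m\<close> is nonzero, then
  \<open>w / m\<close> is the inverse.\<close>

lemma regular_invertible:
  assumes s: "regular_element s"
  shows "\<exists>q\<in>central_localization. qmr_of s * q = 1 \<and> q * qmr_of s = 1"
proof -
  obtain t where t: "t \<in> extended_centroid" "qmr_of s = v s + t" using qmr_of_v by blast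
  define m where "m = v s * v s - t * t"
  have m: "m \<in> extended_centroid" unfolding m_def by (intro extended_centroid_closed v_square t)
  define w where "w = qmr_of s - t - t"
  have sw: "qmr_of s * w = m" "w * qmr_of s = m"
    by (simp_all add: m_def w_def t(2) algebra_simps extended_centroid_commute[OF t(1), of "v s"])
  have w: "w \<in> central_localization"
    unfolding w_def by (intro localization_minus qmr_of_localization extended_centroid_localization t)
  show ?thesis
  proof (cases "m = 0")
    case False
    then obtain n where n: "n \<in> extended_centroid" "m * n = 1" "n * m = 1"
      using extended_centroid_inverse[OF m] by metis
    show ?thesis
    proof (intro bexI[of _ "w * n"] conjI)
      show "w * n \<in> central_localization"
        by (intro localization_mult w extended_centroid_localization n)
      show "qmr_of s * (w * n) = 1" by (simp add: mult.assoc[symmetric] sw n)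
      show "w * n * qmr_of s = 1"
        by (simp add: mult.assoc extended_centroid_commute[OF n(1), of "qmr_of s"])
          (simp add: mult.assoc[symmetric] sw n)
    qed
  next
    \<comment> \<open>Norm zero: \<open>s\<close> annihilates a numerator of \<open>w\<close>, so
      regularity forces \<open>w = 0\<close>. Then \<open>s = 2 t\<close> is a nonzero element of
      the field \<open>extended_centroid\<close>.\<close>
    case True
    obtain z r where z: "z \<in> ring_center" "z \<noteq> 0" "w * qmr_of z = qmr_of r" using localizationE[OF w] .
    have "qmr_of (s * r) = 0"
      by (simp add: qmr_of_mult z(3)[symmetric] mult.assoc[symmetric] sw True)
    then have "r = 0" using s qmr_of_eq_0 unfolding regular_element_def by blast
    then have "qmr_of z * w = 0"
      using z(1,3) extended_centroid_commute[of "qmr_of z" w] by (simp add: qmr_of_extended_centroid qmr_of_zero)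
    then have "w = 0"
      using extended_centroid_cancel[of "qmr_of z" w] z(1,2) qmr_of_extended_centroid qmr_of_eq_0 by blast
    then have "qmr_of s = t + t" by (simp add: w_def algebra_simps)
    then have sc: "qmr_of s \<in> extended_centroid" using t(1) by (simp add: extended_centroid_add)
    obtain a :: 'a where "a \<noteq> 0" using nonzero by blast
    then have "s * a \<noteq> 0" using s unfolding regular_element_def by blast
    then have "s \<noteq> 0" by (metis mult_zero_left)
    then have "qmr_of s \<noteq> 0" using qmr_of_eq_0 by blast
    then obtain n where "n \<in> extended_centroid" "qmr_of s * n = 1" "n * qmr_of s = 1"
      using extended_centroid_inverse[OF sc] by metis
    then show ?thesis using extended_centroid_localization by blast
  qed
qed

end

section \<open>Quaternion coordinates\<close>

lemma extended_centroid_mult_cancel: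
  fixes c :: "'a::prime_ring qmr"
  assumes c: "c \<in> extended_centroid" and cq: "c * q \<in> extended_centroid" and "q \<notin> extended_centroid"
  shows "c = 0"
proof (rule ccontr)
  assume "c \<noteq> 0"
  then obtain d where "d \<in> extended_centroid" "d * c = 1" using extended_centroid_inverse[OF c] by metis
  then have "q \<in> extended_centroid"
    using extended_centroid_mult[OF _ cq, of d] by (simp add: mult.assoc[symmetric])
  then show False using assms(3) by blast
qed

text \<open>Subtracting the projection to the span of \<open>p\<close> and \<open>q\<close>, given by Cramer's rule, leaves an
  element anticommuting with \<open>p\<close> and \<open>q\<close>; it commutes with \<open>p q - q p\<close>, hence is a multiple of it.\<close>

lemma quaternion_span:
  fixes p q w :: "'a::prime_ring qmr"
  assumes two: "\<And>x :: 'a. x + x = 0 \<Longrightarrow> x = 0"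
    and a: "p * p \<in> extended_centroid" and b: "q * q \<in> extended_centroid"
    and c: "p * q + q * p \<in> extended_centroid"
    and s: "w * p + p * w \<in> extended_centroid" and t: "w * q + q * w \<in> extended_centroid"
    and e: "w * (p * q - q * p) + (p * q - q * p) * w \<in> extended_centroid"
    and nz: "(p * q - q * p) * (p * q - q * p) \<noteq> 0"
  shows "\<exists>\<beta>\<in>extended_centroid. \<exists>\<gamma>\<in>extended_centroid. \<exists>\<delta>\<in>extended_centroid.
    w = \<beta> * p + \<gamma> * q + \<delta> * (p * q - q * p)"
proof -
  define a' b' c' s' t' where "a' = p * p" and "b' = q * q" and "c' = p * q + q * p"
    and "s' = w * p + p * w" and "t' = w * q + q * w"
  note defs = a'_def b'_def c'_def s'_def t'_def
  have C: "a' \<in> extended_centroid" "b' \<in> extended_centroid" "c' \<in> extended_centroid"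
    "s' \<in> extended_centroid" "t' \<in> extended_centroid"
    unfolding defs by (rule a b c s t)+
  define u where "u = p * q - q * p"
  note rel = quaternion_relations[OF a[unfolded extended_centroid_def]
      b[unfolded extended_centroid_def] c[unfolded extended_centroid_def], folded u_def defs]
  \<comment> \<open>Requiring \<open>\<beta> p + \<gamma> q\<close> to have the same anticommutators
    with \<open>p\<close> and \<open>q\<close> as \<open>w\<close> means
    \<open>2 a' \<beta> + c' \<gamma> = s'\<close> and
    \<open>c' \<beta> + 2 b' \<gamma> = t'\<close>. The determinant is \<open>N\<close>, and
    Cramer's rule gives \<open>\<beta> = B / N\<close> and \<open>\<gamma> = D / N\<close>.\<close>
  define B where "B = b' * s' + b' * s' - c' * t'"
  define D where "D = a' * t' + a' * t' - c' * s'"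
  define N where "N = a' * b' + a' * b' + a' * b' + a' * b' - c' * c'"
  have BDN: "B \<in> extended_centroid" "D \<in> extended_centroid" "N \<in> extended_centroid"
    unfolding B_def D_def N_def by (intro extended_centroid_closed C)+
  note lc = extended_centroid_left_commute
  define w1 where "w1 = N * w - B * p - D * q"
  have "w1 * p + p * w1 = N * s' - (B * a' + B * a') - D * c'"
    by (simp add: w1_def defs algebra_simps lc[OF BDN(1), of p] lc[OF BDN(2), of p] lc[OF BDN(3), of p])
  also have "\<dots> = 0"
    by (simp add: N_def B_def D_def algebra_simps extended_centroid_commute lc C)
  finally have p1: "w1 * p = - (p * w1)" by (simp add: eq_neg_iff_add_eq_0)
  have "w1 * q + q * w1 = N * t' - B * c' - (D * b' + D * b')"
    by (simp add: w1_def defs algebra_simps lc[OF BDN(1), of q] lc[OF BDN(2), of q] lc[OF BDN(3), of q])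
  also have "\<dots> = 0"
    by (simp add: N_def B_def D_def algebra_simps extended_centroid_commute lc C)
  finally have q1: "w1 * q = - (q * w1)" by (simp add: eq_neg_iff_add_eq_0)
  have "w1 * p * q = p * q * w1" by (simp add: p1 mult.assoc q1)
  moreover have "w1 * q * p = q * p * w1" by (simp add: q1 mult.assoc p1)
  ultimately have wu: "w1 * u = u * w1" by (simp add: u_def algebra_simps)
  \<comment> \<open>The \<open>p\<close> and \<open>q\<close> terms drop out because
    \<open>u\<close> anticommutes with both, so \<open>2 w1 u\<close> is a central multiple of the
    anticommutator of \<open>w\<close> and \<open>u\<close>.\<close>
  have "w1 * u + u * w1 = N * (w * u + u * w) - B * (u * p + p * u) - D * (u * q + q * u)"
    by (simp add: w1_def algebra_simps lc[OF BDN(1), of u] lc[OF BDN(2), of u] lc[OF BDN(3), of u])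
  also have "\<dots> = N * (w * u + u * w)" by (simp add: rel)
  finally have "w1 * u + w1 * u = N * (w * u + u * w)" by (simp only: wu)
  moreover have "N * (w * u + u * w) \<in> extended_centroid"
    using e by (intro extended_centroid_mult BDN) (simp add: u_def)
  ultimately have wuC: "w1 * u \<in> extended_centroid"
    using extended_centroid_half[OF two] by metis
  \<comment> \<open>Since \<open>u^2\<close> is an invertible scalar, \<open>w1\<close> can be
    recovered from the scalar \<open>w1 * u\<close> as a multiple of \<open>u\<close>.\<close>
  have uu: "u * u = - N" by (simp add: rel N_def)
  have N0: "N \<noteq> 0" using nz uu by (auto simp: u_def)
  obtain n where n: "n \<in> extended_centroid" "N * n = 1" "n * N = 1"
    using extended_centroid_inverse[OF BDN(3) N0] .
  have "w1 * N = - (w1 * u * u)" by (simp add: mult.assoc uu)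
  then have "n * (w1 * N) = - (n * (w1 * u) * u)" by (simp add: mult.assoc)
  then have w1: "w1 = - (n * (w1 * u) * u)"
    by (simp add: extended_centroid_commute[OF BDN(3), of w1, symmetric] mult.assoc[symmetric] n)
  have "w = n * (N * w)" by (simp add: mult.assoc[symmetric] n)
  also have "\<dots> = n * (w1 + B * p + D * q)" by (simp add: w1_def)
  also have "\<dots> = n * B * p + n * D * q + n * w1" by (simp add: algebra_simps)
  also have "n * w1 = - (n * (n * (w1 * u))) * u"
    by (subst w1) (simp add: mult.assoc)
  finally have w: "w = n * B * p + n * D * q + - (n * (n * (w1 * u))) * u" .
  show ?thesis
    unfolding u_def[symmetric]
    by (intro bexI, rule w) (intro extended_centroid_closed n BDN wuC)+
qed

text \<open>Anticommuting the relation with \<open>p\<close> and with \<open>q\<close> removes the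
  \<open>\<delta>\<close> term. The first result makes \<open>\<alpha> p\<close> central, so
  \<open>\<alpha> = 0\<close>. What remains is a linear system for \<open>\<beta>\<close> and
  \<open>\<gamma>\<close> with determinant \<open>- u^2\<close>, for \<open>u = p q - q p\<close>,
  and finally \<open>\<delta> u^2 = 0\<close>.\<close>

lemma quaternion_independent:
  fixes p q :: "'a::prime_ring qmr"
  assumes two: "\<And>x :: 'a. x + x = 0 \<Longrightarrow> x = 0"
    and a: "p * p \<in> extended_centroid" and b: "q * q \<in> extended_centroid"
    and c: "p * q + q * p \<in> extended_centroid"
    and nz: "(p * q - q * p) * (p * q - q * p) \<noteq> 0"
    and C: "\<alpha> \<in> extended_centroid" "\<beta> \<in> extended_centroid" "\<gamma> \<in> extended_centroid" "\<delta> \<in> extended_centroid"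
    and 0: "\<alpha> + \<beta> * p + \<gamma> * q + \<delta> * (p * q - q * p) = 0"
  shows "\<alpha> = 0" "\<beta> = 0" "\<gamma> = 0" "\<delta> = 0"
proof -
  define a' b' c' where "a' = p * p" and "b' = q * q" and "c' = p * q + q * p"
  note defs = a'_def b'_def c'_def
  have C': "a' \<in> extended_centroid" "b' \<in> extended_centroid" "c' \<in> extended_centroid"
    unfolding defs by (rule a b c)+
  define u where "u = p * q - q * p"
  note rel = quaternion_relations[OF a[unfolded extended_centroid_def]
      b[unfolded extended_centroid_def] c[unfolded extended_centroid_def], folded u_def defs]
  note lc = extended_centroid_left_commute
  define L where "L = \<alpha> + \<beta> * p + \<gamma> * q + \<delta> * u"
  have L0: "L = 0" using 0 by (simp add: L_def u_def)
  have Lp: "L * p + p * L = \<alpha> * p + \<alpha> * p + (\<beta> * a' + \<beta> * a' + \<gamma> * c') + \<delta> * (u * p + p * u)"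
    by (simp add: L_def defs algebra_simps extended_centroid_commute[OF C(1), of p] lc[OF C(2), of p] lc[OF C(3), of p] lc[OF C(4), of p])
  have Lq: "L * q + q * L = \<alpha> * q + \<alpha> * q + (\<beta> * c' + \<gamma> * b' + \<gamma> * b') + \<delta> * (u * q + q * u)"
    by (simp add: L_def defs algebra_simps extended_centroid_commute[OF C(1), of q] lc[OF C(2), of q] lc[OF C(3), of q] lc[OF C(4), of q])
  have "\<alpha> * p + \<alpha> * p + (\<beta> * a' + \<beta> * a' + \<gamma> * c') = 0"
    using Lp by (simp add: L0 rel)
  then have "\<alpha> * p + \<alpha> * p = - (\<beta> * a' + \<beta> * a' + \<gamma> * c')"
    by (simp only: eq_neg_iff_add_eq_0)
  moreover have "- (\<beta> * a' + \<beta> * a' + \<gamma> * c') \<in> extended_centroid"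
    by (intro extended_centroid_closed C C')
  ultimately have "\<alpha> * p \<in> extended_centroid" using extended_centroid_half[OF two] by metis
  moreover have "p \<notin> extended_centroid"
  proof
    assume "p \<in> extended_centroid"
    then have "u = 0" by (simp add: u_def extended_centroid_commute[of p q])
    then show False using nz by (simp add: u_def)
  qed
  ultimately show \<alpha>: "\<alpha> = 0" using extended_centroid_mult_cancel[OF C(1)] by blast
  have 1: "\<beta> * a' + \<beta> * a' + \<gamma> * c' = 0" using Lp by (simp add: L0 rel \<alpha>)
  have 2: "\<beta> * c' + \<gamma> * b' + \<gamma> * b' = 0" using Lq by (simp add: L0 rel \<alpha>)
  have uu: "u * u = c' * c' - (a' * b' + a' * b' + a' * b' + a' * b')" by (rule rel)
  have uuC: "u * u \<in> extended_centroid" unfolding uu by (intro extended_centroid_closed C')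
  have uu0: "u * u \<noteq> 0" using nz by (simp add: u_def)
  have "u * u * \<beta> = (\<beta> * c' + \<gamma> * b' + \<gamma> * b') * c'
      - ((\<beta> * a' + \<beta> * a' + \<gamma> * c') * b' + (\<beta> * a' + \<beta> * a' + \<gamma> * c') * b')"
    by (simp add: uu algebra_simps extended_centroid_commute lc C C')
  then have "u * u * \<beta> = 0" by (simp add: 1 2)
  then show "\<beta> = 0" by (rule extended_centroid_cancel[OF uuC uu0])
  have "u * u * \<gamma> = (\<beta> * a' + \<beta> * a' + \<gamma> * c') * c'
      - ((\<beta> * c' + \<gamma> * b' + \<gamma> * b') * a' + (\<beta> * c' + \<gamma> * b' + \<gamma> * b') * a')"
    by (simp add: uu algebra_simps extended_centroid_commute lc C C')
  then have "u * u * \<gamma> = 0" by (simp add: 1 2)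
  then show "\<gamma> = 0" by (rule extended_centroid_cancel[OF uuC uu0])
  have "\<delta> * (u * u) = 0"
    using L0 by (simp add: L_def \<alpha> \<open>\<beta> = 0\<close> \<open>\<gamma> = 0\<close> mult.assoc[symmetric])
  then have "u * u * \<delta> = 0" by (simp only: extended_centroid_commute[OF C(4)])
  then show "\<delta> = 0" by (rule extended_centroid_cancel[OF uuC uu0])
qed

context quadratic_prime_ring
begin

text \<open>Clear the denominator \<open>z\<close> of \<open>q\<close> and apply
  \<open>quaternion_span\<close> to the trace-zero part of the numerator. Passing from
  \<open>v x\<close>, \<open>v y\<close> back to \<open>x\<close>, \<open>y\<close> only changes the
  constant coefficient.\<close>

lemma quaternion_basis_span:
  fixes x y :: 'a
  assumes nz: "commutator x y * commutator x y \<noteq> 0" and q: "q \<in> central_localization"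
  shows "\<exists>\<alpha>\<in>extended_centroid. \<exists>\<beta>\<in>extended_centroid. \<exists>\<gamma>\<in>extended_centroid. \<exists>\<delta>\<in>extended_centroid.
    q = \<alpha> + \<beta> * qmr_of x + \<gamma> * qmr_of y + \<delta> * qmr_of (commutator x y)"
proof -
  obtain z w where z: "z \<in> ring_center" "z \<noteq> 0" "q * qmr_of z = qmr_of w" using localizationE[OF q] .
  have zC: "qmr_of z \<in> extended_centroid" using z(1) by (simp add: qmr_of_extended_centroid)
  have "qmr_of z \<noteq> 0" using z(2) qmr_of_eq_0 by blast
  then obtain n where n: "n \<in> extended_centroid" "qmr_of z * n = 1" "n * qmr_of z = 1"
    using extended_centroid_inverse[OF zC] by metis
  let ?u = "qmr_of (commutator x y)"
  have u: "v x * v y - v y * v x = ?u" by (simp add: qmr_of_commutator)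
  have uu: "?u * ?u \<noteq> 0" using nz qmr_of_eq_0 by (auto simp: qmr_of_mult[symmetric])
  have "commutator x y \<noteq> 0" using nz by auto
  then have "v w * ?u + ?u * v w \<in> extended_centroid"
    using v_anticomm[of w "commutator x y"] by (simp add: v_commutator)
  then obtain \<beta> \<gamma> \<delta> where C: "\<beta> \<in> extended_centroid" "\<gamma> \<in> extended_centroid" "\<delta> \<in> extended_centroid"
    and w: "v w = \<beta> * v x + \<gamma> * v y + \<delta> * ?u"
    using quaternion_span[OF two v_square v_square v_anticomm v_anticomm v_anticomm, of w x y, unfolded u] uu
    by blast
  obtain s where s: "s \<in> extended_centroid" "qmr_of x = v x + s" using qmr_of_v by blast
  obtain t where t: "t \<in> extended_centroid" "qmr_of y = v y + t" using qmr_of_v by blast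
  obtain r where r: "r \<in> extended_centroid" "qmr_of w = v w + r" using qmr_of_v by blast
  have "q = q * qmr_of z * n" by (simp add: mult.assoc n)
  also have "\<dots> = n * qmr_of w" by (simp add: z(3) extended_centroid_commute[OF n(1)])
  also have "\<dots> = n * (r - \<beta> * s - \<gamma> * t) + n * \<beta> * qmr_of x + n * \<gamma> * qmr_of y + n * \<delta> * ?u"
    by (simp add: r(2) w s(2) t(2) algebra_simps)
  finally have q': "q = n * (r - \<beta> * s - \<gamma> * t) + n * \<beta> * qmr_of x + n * \<gamma> * qmr_of y + n * \<delta> * ?u" .
  show ?thesis
    by (intro bexI, rule q') (intro extended_centroid_closed n r s t C)+
qed

lemma quaternion_basis_independent:
  fixes x y :: 'a
  assumes nz: "commutator x y * commutator x y \<noteq> 0"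
    and C: "\<alpha> \<in> extended_centroid" "\<beta> \<in> extended_centroid" "\<gamma> \<in> extended_centroid" "\<delta> \<in> extended_centroid"
    and 0: "\<alpha> + \<beta> * qmr_of x + \<gamma> * qmr_of y + \<delta> * qmr_of (commutator x y) = 0"
  shows "\<alpha> = 0" "\<beta> = 0" "\<gamma> = 0" "\<delta> = 0"
proof -
  let ?u = "qmr_of (commutator x y)"
  have u: "v x * v y - v y * v x = ?u" by (simp add: qmr_of_commutator)
  have uu: "?u * ?u \<noteq> 0" using nz qmr_of_eq_0 by (auto simp: qmr_of_mult[symmetric])
  obtain s where s: "s \<in> extended_centroid" "qmr_of x = v x + s" using qmr_of_v by blast
  obtain t where t: "t \<in> extended_centroid" "qmr_of y = v y + t" using qmr_of_v by blast
  have C1: "\<alpha> + \<beta> * s + \<gamma> * t \<in> extended_centroid" by (intro extended_centroid_closed C s t)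
  have "(\<alpha> + \<beta> * s + \<gamma> * t) + \<beta> * v x + \<gamma> * v y + \<delta> * ?u = 0"
    using 0 by (simp add: s(2) t(2) algebra_simps)
  note ind = quaternion_independent[OF two v_square v_square v_anticomm, of x y, unfolded u,
      OF _ uu C1 C(2-4) this]
  show "\<beta> = 0" "\<gamma> = 0" "\<delta> = 0" by (rule ind, assumption)+
  moreover have "\<alpha> + \<beta> * s + \<gamma> * t = 0" by (rule ind, assumption)
  ultimately show "\<alpha> = 0" by simp
qed

end

section \<open>Transport of a subring to a record of HOL-Algebra\<close>

text \<open>For \<open>\<phi>\<close> injective on a subring \<open>S\<close>, this is an isomorphic
  copy of \<open>S\<close> carried by the type \<open>'c\<close>. It is needed because the
  conclusion asks for a ring on the type \<open>('a \<times> 'a) set\<close>.\<close>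

definition transported_ring :: "('b::ring_1 \<Rightarrow> 'c) \<Rightarrow> 'b set \<Rightarrow> 'c ring" where
  "transported_ring \<phi> S = \<lparr>carrier = \<phi> ` S, mult = \<lambda>a b. \<phi> (inv_into S \<phi> a * inv_into S \<phi> b),
     one = \<phi> 1, zero = \<phi> 0, add = \<lambda>a b. \<phi> (inv_into S \<phi> a + inv_into S \<phi> b)\<rparr>"

locale transported =
  fixes \<phi> :: "'b::ring_1 \<Rightarrow> 'c" and S :: "'b set" and A :: "'c ring" (structure)
  assumes A_def: "A = transported_ring \<phi> S"
    and inj: "inj_on \<phi> S"
    and closed: "0 \<in> S" "1 \<in> S" "p \<in> S \<Longrightarrow> q \<in> S \<Longrightarrow> p + q \<in> S" "p \<in> S \<Longrightarrow> - p \<in> S"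
      "p \<in> S \<Longrightarrow> q \<in> S \<Longrightarrow> p * q \<in> S"
begin

lemma carrier: "carrier A = \<phi> ` S"
  and one: "\<one> = \<phi> 1"
  and zero: "\<zero> = \<phi> 0"
  and mult: "p \<in> S \<Longrightarrow> q \<in> S \<Longrightarrow> \<phi> p \<otimes> \<phi> q = \<phi> (p * q)"
  and add: "p \<in> S \<Longrightarrow> q \<in> S \<Longrightarrow> \<phi> p \<oplus> \<phi> q = \<phi> (p + q)"
  by (simp_all add: A_def transported_ring_def inj)

lemmas ops = carrier one zero mult add closed

lemma eq_iff: "p \<in> S \<Longrightarrow> q \<in> S \<Longrightarrow> \<phi> p = \<phi> q \<longleftrightarrow> p = q"
  using inj by (auto simp: inj_on_def)

lemma is_ring: "Ring.ring A"
proof (rule ringI)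
  show "abelian_group A"
  proof (rule abelian_groupI)
    show "\<exists>y\<in>carrier A. y \<oplus> x = \<zero>" if x: "x \<in> carrier A" for x
    proof -
      obtain p where p: "p \<in> S" "x = \<phi> p" using x by (auto simp: carrier)
      show ?thesis by (rule bexI[of _ "\<phi> (- p)"]) (simp_all add: p ops)
    qed
  qed (auto simp: ops ac_simps)
  show "Group.monoid A"
    by (rule monoidI) (auto simp: ops mult.assoc)
qed (auto simp: ops distrib_left distrib_right)

sublocale A: Ring.ring A
  by (rule is_ring)

lemma uminus: "p \<in> S \<Longrightarrow> \<ominus> \<phi> p = \<phi> (- p)"
  by (rule A.minus_equality) (simp_all add: ops)

lemma Units_inv:
  assumes "p \<in> S" "q \<in> S" "p * q = 1" "q * p = 1"
  shows "\<phi> p \<in> Units A" "inv \<phi> p = \<phi> q"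
proof -
  show "\<phi> p \<in> Units A" unfolding Units_def using assms by (auto simp: ops intro!: bexI[of _ q])
  show "inv \<phi> p = \<phi> q"
    using assms by (intro A.inv_char) (auto simp: ops)
qed

lemma center: "center_of A = \<phi> ` {p \<in> S. \<forall>q\<in>S. p * q = q * p}"
  unfolding center_of_def using eq_iff by (auto simp: ops)

lemma center_subfield:
  assumes C: "{p \<in> S. \<forall>q\<in>S. p * q = q * p} = C" and one0: "(1::'b) \<noteq> 0"
    and inv: "\<And>p. p \<in> C \<Longrightarrow> p \<noteq> 0 \<Longrightarrow> \<exists>q\<in>C. p * q = 1"
  shows "subfield (center_of A) A"
proof -
  let ?K = "\<phi> ` C"
  have K: "center_of A = ?K" by (simp add: center C)
  have CS: "p \<in> S" if "p \<in> C" for p using that C by blast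
  have comm: "p * q = q * p" if "p \<in> C" "q \<in> S" for p q using that C by blast
  have Cmem: "p \<in> C" if "p \<in> S" "\<And>q. q \<in> S \<Longrightarrow> p * q = q * p" for p using that C by blast
  have Cc: "1 \<in> C" "0 \<in> C" "p \<in> C \<Longrightarrow> - p \<in> C" "p \<in> C \<Longrightarrow> q \<in> C \<Longrightarrow> p + q \<in> C" for p q
    by (auto intro!: Cmem simp: closed CS comm distrib_left distrib_right)
  have Cm: "p * q \<in> C" if "p \<in> C" "q \<in> C" for p q
  proof (rule Cmem)
    show "p * q \<in> S" using that by (simp add: closed CS)
    show "p * q * r = r * (p * q)" if "r \<in> S" for r
    proof -
      have "p * q * r = p * r * q" by (simp only: mult.assoc comm[OF \<open>q \<in> C\<close> that])
      also have "\<dots> = r * (p * q)" by (simp only: mult.assoc comm[OF \<open>p \<in> C\<close> that])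
      finally show ?thesis .
    qed
  qed
  have "subcring ?K A"
  proof (rule A.subcringI)
    show "subring ?K A"
      by (rule A.subringI) (auto simp: ops CS Cc Cm uminus)
  qed (auto simp: ops CS comm)
  moreover have "Units (A\<lparr>carrier := ?K\<rparr>) = ?K - {\<zero>}"
  proof
    show "Units (A\<lparr>carrier := ?K\<rparr>) \<subseteq> ?K - {\<zero>}"
      using one0 by (auto simp: Units_def ops CS eq_iff)
    show "?K - {\<zero>} \<subseteq> Units (A\<lparr>carrier := ?K\<rparr>)"
    proof
      fix k assume "k \<in> ?K - {\<zero>}"
      then obtain p where p: "p \<in> C" "k = \<phi> p" "p \<noteq> 0" by (auto simp: zero)
      then obtain q where q: "q \<in> C" "p * q = 1" using inv by blast
      then have "q * p = 1" using comm[OF p(1) CS[OF q(1)]] by simp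
      then show "k \<in> Units (A\<lparr>carrier := ?K\<rparr>)"
        using p q by (auto simp: Units_def ops CS intro!: bexI[of _ q])
    qed
  qed
  ultimately show ?thesis unfolding K by (rule A.subfieldI)
qed

end

section \<open>The localization as a central simple algebra containing the ring as an order\<close>

text \<open>Encodes \<open>q\<close> canonically by all of its right fractions \<open>r / s\<close>
  with regular denominator, thus by an element of the required type.\<close>

definition fractions_of :: "'a::prime_ring qmr \<Rightarrow> ('a \<times> 'a) set" where
  "fractions_of q = {(r, s). regular_element s \<and> q * qmr_of s = qmr_of r}"

lemma regular_center:
  fixes z :: "'a::prime_ring"
  assumes "z \<in> ring_center" "z \<noteq> 0"
  shows "regular_element z"
  unfolding regular_element_def
proof (intro conjI allI impI)
  show "x = 0" if "z * x = 0" for x using that by (rule ring_center_cancel[OF assms])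
  show "x = 0" if "x * z = 0" for x
    by (rule ring_center_cancel[OF assms]) (use that in \<open>simp only: ring_center_commute[OF assms(1), of x]\<close>)
qed

context quadratic_prime_ring
begin

text \<open>An element of the localization has a fraction with a central denominator
  \<open>z\<close>. Any \<open>q\<close> sharing it satisfies \<open>z (p - q) = 0\<close>, and
  \<open>z\<close> cancels.\<close>

lemma inj_on_fractions_of: "inj_on fractions_of central_localization"
proof (rule inj_onI)
  fix p q :: "'a qmr"
  assume p: "p \<in> central_localization" and eq: "fractions_of p = fractions_of q"
  obtain z r where z: "z \<in> ring_center" "z \<noteq> 0" "p * qmr_of z = qmr_of r" using localizationE[OF p] .
  have "(r, z) \<in> fractions_of p"
    using z by (simp add: fractions_of_def regular_center)
  then have "q * qmr_of z = p * qmr_of z" unfolding eq by (simp add: fractions_of_def z(3))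
  then have "qmr_of z * (p - q) = 0"
    using extended_centroid_commute[of "qmr_of z" "p - q"] z(1)
    by (simp add: qmr_of_extended_centroid left_diff_distrib)
  then have "p - q = 0"
    using extended_centroid_cancel[of "qmr_of z" "p - q"] z(1,2) qmr_of_extended_centroid qmr_of_eq_0 by blast
  then show "p = q" by simp
qed

sublocale A: transported fractions_of central_localization
    "transported_ring fractions_of central_localization"
proof
  show "0 \<in> central_localization" "1 \<in> central_localization"
    by (intro extended_centroid_localization extended_centroid_closed)+
qed (simp_all add: inj_on_fractions_of localization_add localization_uminus localization_mult)

abbreviation "A \<equiv> transported_ring fractions_of central_localization"

lemma localization_center:
  "{p \<in> central_localization. \<forall>q\<in>central_localization. p * q = q * p} = extended_centroid"
  using extended_centroid_localization localization_central extended_centroid_commute by blast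

lemma center_A: "center_of A = fractions_of ` extended_centroid"
  by (simp add: A.center localization_center)

lemma center_A_subfield: "subfield (center_of A) A"
proof (rule A.center_subfield[OF localization_center])
  show "\<exists>q\<in>extended_centroid. p * q = 1" if "p \<in> extended_centroid" "p \<noteq> 0" for p :: "'a qmr"
    using extended_centroid_inverse[OF that] by metis
qed simp

text \<open>A nonzero ideal of \<open>A\<close> contracts to a nonzero ideal \<open>K\<close> of the
  ring, as clearing denominators shows. By \<open>dense_ideal_center\<close> the latter contains a
  nonzero central element, which is a unit of \<open>A\<close>.\<close>

lemma simple_A: "simple_ring A"
  unfolding simple_ring_def
proof (intro conjI allI impI)
  let ?e = "\<lambda>r::'a. fractions_of (qmr_of r)"
  have loc: "p \<in> central_localization" if "p \<in> extended_centroid" for p :: "'a qmr"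
    using that by (rule extended_centroid_localization)
  show "Ring.ring A" by (rule A.is_ring)
  show "carrier A \<noteq> {\<zero>\<^bsub>A\<^esub>}"
    using A.eq_iff[of 1 0] A.closed by (auto simp: A.carrier A.zero)
  fix I assume "ideal I A"
  then interpret I: ideal I A .
  have IS: "\<exists>p\<in>central_localization. a = fractions_of p" if "a \<in> I" for a
    using I.a_subset that by (auto simp: A.carrier)
  show "I = {\<zero>\<^bsub>A\<^esub>} \<or> I = carrier A"
  proof (cases "I = {\<zero>\<^bsub>A\<^esub>}")
    case False
    then obtain a where a: "a \<in> I" "a \<noteq> \<zero>\<^bsub>A\<^esub>" using I.zero_closed by blast
    obtain p where p: "p \<in> central_localization" "a = fractions_of p" using IS[OF a(1)] by blast
    have p0: "p \<noteq> 0" using a(2) p(2) by (auto simp: A.zero)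
    obtain z r where z: "z \<in> ring_center" "z \<noteq> 0" "p * qmr_of z = qmr_of r" using localizationE[OF p(1)] .
    define K where "K = {r. ?e r \<in> I}"
    have mult_r: "fractions_of (q * s) \<in> I" and mult_l: "fractions_of (s * q) \<in> I"
      if "fractions_of q \<in> I" "q \<in> central_localization" "s \<in> central_localization" for q s
      using I.I_r_closed[OF that(1), of "fractions_of s"] I.I_l_closed[OF that(1), of "fractions_of s"] that
      by (simp_all add: A.ops)
    have "dense_ideal K"
    proof (rule dense_idealI)
      show "right_ideal K"
        unfolding right_ideal_def
      proof (intro conjI ballI allI)
        show "0 \<in> K" using I.zero_closed by (simp add: K_def qmr_of_zero A.zero)
        show "x - y \<in> K" if "x \<in> K" "y \<in> K" for x y
        proof -
          have "fractions_of (qmr_of y * - 1) \<in> I"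
            using that by (intro mult_r qmr_of_localization A.closed) (simp add: K_def)
          then have "?e x \<oplus>\<^bsub>A\<^esub> fractions_of (- qmr_of y) \<in> I"
            using that by (intro I.a_closed) (simp_all add: K_def)
          then show ?thesis
            by (simp add: K_def qmr_of_diff A.add A.closed qmr_of_localization)
        qed
        show "x * s \<in> K" if "x \<in> K" for x s
          using that by (simp add: K_def qmr_of_mult mult_r qmr_of_localization)
      qed
      show "s * x \<in> K" if "x \<in> K" for x s
        using that by (simp add: K_def qmr_of_mult mult_l qmr_of_localization)
      show "r \<in> K"
        using mult_r[of p "qmr_of z"] a(1) p by (simp add: K_def z(3)[symmetric] qmr_of_localization)
      show "r \<noteq> 0"
      proof
        assume "r = 0"
        then have "qmr_of z * p = 0"
          using z(1,3) extended_centroid_commute[of "qmr_of z" p] by (simp add: qmr_of_extended_centroid qmr_of_zero)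
        then show False
          using extended_centroid_cancel[of "qmr_of z" p] z(1,2) p0 qmr_of_extended_centroid qmr_of_eq_0 by blast
      qed
    qed
    then obtain y where y: "y \<in> K" "y \<in> ring_center" "y \<noteq> 0" using dense_ideal_center by blast
    then obtain n where n: "n \<in> extended_centroid" "qmr_of y * n = 1"
      using extended_centroid_inverse[of "qmr_of y"] qmr_of_extended_centroid qmr_of_eq_0 by metis
    have "fractions_of (qmr_of y * n) \<in> I"
      using y(1) by (intro mult_r qmr_of_localization loc n) (simp add: K_def)
    then have "I = carrier A" by (intro I.one_imp_carrier) (simp add: n A.one)
    then show ?thesis ..
  qed simp
qed

lemma dimension_A: "ring.dimension A 4 (center_of A) (carrier A)"
proof -
  obtain x y :: 'a where xy: "commutator x y * commutator x y \<noteq> 0"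
    using dense_ideal_commutator_square[OF dense_ideal_UNIV] by blast
  define Us where "Us = map fractions_of [1, qmr_of x, qmr_of y, qmr_of (commutator x y)]"
  have Us: "set Us \<subseteq> carrier A" by (auto simp: Us_def A.ops qmr_of_localization)
  note K = center_A_subfield
  have comb: "A.A.combine [fractions_of \<alpha>, fractions_of \<beta>, fractions_of \<gamma>, fractions_of \<delta>] Us
      = fractions_of (\<alpha> + \<beta> * qmr_of x + \<gamma> * qmr_of y + \<delta> * qmr_of (commutator x y))"
    if "\<alpha> \<in> extended_centroid" "\<beta> \<in> extended_centroid" "\<gamma> \<in> extended_centroid" "\<delta> \<in> extended_centroid"
    for \<alpha> \<beta> \<gamma> \<delta>
    using that by (simp add: Us_def A.ops qmr_of_localization extended_centroid_localization add.assoc)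
  have "A.A.independent (center_of A) Us"
  proof (rule A.A.trivial_combine_imp_independent[OF K Us])
    fix Ks assume Ks: "set Ks \<subseteq> center_of A" "A.A.combine Ks Us = \<zero>\<^bsub>A\<^esub>"
    \<comment> \<open>The coefficient list may have any length; it is cut or padded with zeros to
      length four before the coordinates are read off.\<close>
    obtain Ks' where Ks': "set (take (length Us) Ks) \<subseteq> set Ks'" "set Ks' \<subseteq> set (take (length Us) Ks) \<union> {\<zero>\<^bsub>A\<^esub>}"
      "length Ks' = length Us" "A.A.combine Ks' Us = \<zero>\<^bsub>A\<^esub>"
      by (rule A.A.combine_normalize[OF _ Us Ks(2)]) (use Ks(1) subfieldE(3)[OF K] in blast)
    have "\<zero>\<^bsub>A\<^esub> \<in> center_of A" by (auto simp: center_A A.zero extended_centroid_zero)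
    then have "set Ks' \<subseteq> center_of A" using Ks'(2) Ks(1) set_take_subset[of "length Us" Ks] by blast
    moreover obtain k1 k2 k3 k4 where k: "Ks' = [k1, k2, k3, k4]"
      using Ks'(3) by (auto simp: Us_def length_Suc_conv)
    ultimately obtain \<alpha> \<beta> \<gamma> \<delta> where C: "\<alpha> \<in> extended_centroid" "\<beta> \<in> extended_centroid"
      "\<gamma> \<in> extended_centroid" "\<delta> \<in> extended_centroid"
      and Ks'_eq: "Ks' = [fractions_of \<alpha>, fractions_of \<beta>, fractions_of \<gamma>, fractions_of \<delta>]"
      by (auto simp: center_A)
    let ?q = "\<alpha> + \<beta> * qmr_of x + \<gamma> * qmr_of y + \<delta> * qmr_of (commutator x y)"
    have "?q \<in> central_localization"
      by (intro A.closed qmr_of_localization extended_centroid_localization C)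
    then have "?q = 0"
      using Ks'(4) A.eq_iff[of ?q 0] A.closed(1) unfolding Ks'_eq comb[OF C] A.zero by blast
    from quaternion_basis_independent[OF xy C this] show "set (take (length Us) Ks) \<subseteq> {\<zero>\<^bsub>A\<^esub>}"
      using Ks'(1) by (simp add: Ks'_eq A.zero)
  qed
  then have "A.A.dimension (length Us) (center_of A) (A.A.Span (center_of A) Us)"
    by (rule A.A.dimension_independent)
  moreover have "A.A.Span (center_of A) Us = carrier A"
  proof
    show "A.A.Span (center_of A) Us \<subseteq> carrier A" using A.A.Span_in_carrier[OF subfieldE(3)[OF K] Us] .
    show "carrier A \<subseteq> A.A.Span (center_of A) Us"
    proof
      fix a assume "a \<in> carrier A"
      then obtain q where q: "q \<in> central_localization" "a = fractions_of q" by (auto simp: A.carrier)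
      obtain \<alpha> \<beta> \<gamma> \<delta> where C: "\<alpha> \<in> extended_centroid" "\<beta> \<in> extended_centroid"
        "\<gamma> \<in> extended_centroid" "\<delta> \<in> extended_centroid"
        "q = \<alpha> + \<beta> * qmr_of x + \<gamma> * qmr_of y + \<delta> * qmr_of (commutator x y)"
        using quaternion_basis_span[OF xy q(1)] by blast
      have "a = A.A.combine [fractions_of \<alpha>, fractions_of \<beta>, fractions_of \<gamma>, fractions_of \<delta>] Us"
        unfolding comb[OF C(1-4)] by (simp add: q(2) C(5))
      moreover have "set [fractions_of \<alpha>, fractions_of \<beta>, fractions_of \<gamma>, fractions_of \<delta>] \<subseteq> center_of A"
        using C by (simp add: center_A)
      ultimately show "a \<in> A.A.Span (center_of A) Us"
        unfolding A.A.Span_eq_combine_set[OF K Us] by blast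
    qed
  qed
  moreover have "length Us = 4" by (simp add: Us_def)
  ultimately show ?thesis by (simp only:)
qed

text \<open>Regular elements become units by \<open>regular_invertible\<close>. A central
  denominator is itself regular and can be written on either side, so one pair \<open>r\<close>,
  \<open>z\<close> provides both kinds of fraction.\<close>

lemma order_in_A: "order_in (\<lambda>r. fractions_of (qmr_of r)) A"
  unfolding order_in_def rng_embedding_def
proof (intro conjI allI impI ballI)
  let ?e = "\<lambda>r::'a. fractions_of (qmr_of r)"
  show "Ring.ring A" by (rule A.is_ring)
  show "inj ?e" by (rule injI) (simp add: A.eq_iff[OF qmr_of_localization qmr_of_localization] qmr_of_inject)
  show "range ?e \<subseteq> carrier A" by (auto simp: A.carrier qmr_of_localization)
  show "?e (r + s) = ?e r \<oplus>\<^bsub>A\<^esub> ?e s" "?e (r * s) = ?e r \<otimes>\<^bsub>A\<^esub> ?e s" for r s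
    by (simp_all add: A.ops qmr_of_localization qmr_of_add qmr_of_mult)
  show "?e s \<in> Units A" if "regular_element s" for s
    using regular_invertible[OF that] A.Units_inv(1)[OF qmr_of_localization] by blast
  fix a assume "a \<in> carrier A"
  then obtain q where q: "q \<in> central_localization" "a = fractions_of q" by (auto simp: A.carrier)
  obtain z r where z: "z \<in> ring_center" "z \<noteq> 0" "q * qmr_of z = qmr_of r" using localizationE[OF q(1)] .
  have reg: "regular_element z" by (rule regular_center[OF z(1,2)])
  obtain n where n: "n \<in> central_localization" "qmr_of z * n = 1" "n * qmr_of z = 1"
    using regular_invertible[OF reg] by blast
  have inv: "inv\<^bsub>A\<^esub> (?e z) = fractions_of n" by (rule A.Units_inv(2)[OF qmr_of_localization n])
  have "qmr_of r * n = q" by (simp add: z(3)[symmetric] mult.assoc n)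
  moreover have "n * qmr_of r = q"
  proof -
    have "qmr_of r = qmr_of z * q"
      using z(1) by (simp add: z(3)[symmetric] extended_centroid_commute[of "qmr_of z" q] qmr_of_extended_centroid)
    then show ?thesis by (simp add: mult.assoc[symmetric] n)
  qed
  ultimately have "a = ?e r \<otimes>\<^bsub>A\<^esub> inv\<^bsub>A\<^esub> (?e z)" "a = inv\<^bsub>A\<^esub> (?e z) \<otimes>\<^bsub>A\<^esub> ?e r"
    using q(2) n(1) by (simp_all add: inv A.mult qmr_of_localization)
  then show "\<exists>r s. regular_element s \<and> a = ?e r \<otimes>\<^bsub>A\<^esub> inv\<^bsub>A\<^esub> (?e s)"
    "\<exists>t u. regular_element t \<and> a = inv\<^bsub>A\<^esub> (?e t) \<otimes>\<^bsub>A\<^esub> ?e u"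
    using reg by blast+
qed

theorem order_in_central_simple: "order_in_central_simple_of_dim_le 4 TYPE('a)"
  unfolding order_in_central_simple_of_dim_le_def central_simple_of_dim_def
  using simple_A center_A_subfield dimension_A order_in_A by blast

end

section \<open>The Jordan condition and the two cases\<close>

theorem theorem3p7:
  fixes star G :: "'a::prime_ring \<Rightarrow> 'a"
  assumes "\<exists>x y :: 'a. x * y \<noteq> y * x"
    and "rng_char TYPE('a) \<noteq> 2"
    and "involution star"
    and "ce_jordan_epimorphism G"
    and "\<And>x. commutator (G x) (star x) \<in> ring_center"
  shows "order_in_central_simple_of_dim_le 4 TYPE('a) \<or>
    (\<exists>l\<in>extended_centroid. \<forall>x. qmr_of (G x) = ext_involution star l * qmr_of (star x))"
proof -
  note two = two_torsion_free[OF assms(2)]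
  note inv = star_add[OF assms(3)] star_mult[OF assms(3)] star_star[OF assms(3)]
  define F where "F x = G (star x)" for x
  have G: "G (x + y) - G x - G y \<in> ring_center"
    "G (jordan_prod x y) - jordan_prod (G x) (G y) \<in> ring_center" for x y
    using assms(4) by (simp_all add: ce_jordan_epimorphism_def ce_jordan_endomorphism_def)
  have add: "F (x + y) - F x - F y \<in> ring_center" for x y
    using G(1) by (simp add: F_def inv)
  have "star (jordan_prod x y) = jordan_prod (star x) (star y)" for x y
    by (simp add: jordan_prod_def inv add.commute)
  then have jordan: "F (jordan_prod x y) - jordan_prod (F x) (F y) \<in> ring_center" for x y
    using G(2) by (simp add: F_def)
  have "commutator (F x) x \<in> ring_center" for x
    using assms(5)[of "star x"] by (simp add: F_def inv)
  then have com: "commutator (F x) x = 0" for x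
    using centralizing_imp_commuting[of F, OF two add] by blast
  obtain c where c: "c \<in> extended_centroid" "\<And>x. qmr_of (F x) - c * qmr_of x \<in> extended_centroid"
    using commuting_map_form[of F, OF assms(1) add com] by blast
  define m where "m x = qmr_of (F x) - c * qmr_of x" for x
  have m: "m x \<in> extended_centroid" and F: "qmr_of (F x) = c * qmr_of x + m x" for x
    using c(2) by (simp_all add: m_def)
  note lc = extended_centroid_left_commute[OF c(1)]
  \<comment> \<open>Substituting \<open>F x = c x + m x\<close> into the Jordan condition leaves
    this expression up to the terms \<open>m (jordan_prod x y)\<close> and
    \<open>2 (m x) (m y)\<close>, which lie in the extended centroid.\<close>
  have key: "(c - c * c) * (qmr_of x * qmr_of y + qmr_of y * qmr_of x)
      - (c * m y * qmr_of x + c * m y * qmr_of x + (c * m x * qmr_of y + c * m x * qmr_of y)) \<in> extended_centroid"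
    (is "?k \<in> _") for x y
  proof -
    have mc: "m u * (c * qmr_of w) = qmr_of w * (c * m u)" for u w
      by (simp only: extended_centroid_commute[OF m] mult.assoc lc[of "qmr_of w"])
    have "?k = qmr_of (F (jordan_prod x y) - jordan_prod (F x) (F y)) - m (jordan_prod x y)
        + (m x * m y + m y * m x)"
      by (simp add: qmr_of_diff F) (simp add: jordan_prod_def qmr_of_add qmr_of_mult F algebra_simps mc
          lc[of "qmr_of x"] lc[of "qmr_of y"] lc[of "m x"] lc[of "m y"]
          extended_centroid_commute[OF m, of y "qmr_of x"] extended_centroid_commute[OF m, of x "qmr_of y"])
    then show ?thesis
      using jordan[of x y] by (auto intro!: extended_centroid_closed m simp: qmr_of_extended_centroid)
  qed
  obtain x0 y0 :: 'a where xy0: "x0 * y0 \<noteq> y0 * x0" using assms(1) by blast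
  then have x0: "x0 \<notin> ring_center" by (auto simp: ring_center_def)
  show ?thesis
  proof (cases "c - c * c = 0")
    case True
    \<comment> \<open>With \<open>c = 0\<close> all values of \<open>F\<close> would be central, but
      surjectivity of \<open>G\<close> makes the noncentral \<open>x0\<close> a value.\<close>
    have "c \<noteq> 0"
    proof
      assume "c = 0"
      then have "F x \<in> ring_center" for x using F m by (simp add: qmr_of_extended_centroid[symmetric])
      moreover obtain x where "G x = x0" using assms(4) unfolding ce_jordan_epimorphism_def by (metis surjD)
      then have "F (star x) = x0" by (simp add: F_def inv)
      ultimately show False using x0 by metis
    qed
    moreover have "c * (1 - c) = 0" using True by (simp add: right_diff_distrib)
    ultimately have "1 - c = 0" using extended_centroid_cancel[OF c(1)] by blast
    then have c1: "c = 1" by simp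
    have mxy: "m y * qmr_of x + m x * qmr_of y \<in> extended_centroid" for x y
    proof (rule extended_centroid_half[OF two])
      have "- (m y * qmr_of x + m y * qmr_of x + (m x * qmr_of y + m x * qmr_of y)) \<in> extended_centroid"
        using key[of x y] by (simp add: c1)
      from extended_centroid_uminus[OF this]
      show "m y * qmr_of x + m x * qmr_of y + (m y * qmr_of x + m x * qmr_of y) \<in> extended_centroid"
        by (simp add: algebra_simps)
    qed
    \<comment> \<open>Setting \<open>y = x\<close> in \<open>mxy\<close> puts
      \<open>m x * qmr_of x\<close> in the extended centroid, impossible for noncentral
      \<open>x\<close> unless \<open>m x = 0\<close>.\<close>
    have m0: "m x = 0" if "x \<notin> ring_center" for x
    proof (rule extended_centroid_mult_cancel[OF m])
      show "m x * qmr_of x \<in> extended_centroid" by (rule extended_centroid_half[OF two mxy])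
      show "qmr_of x \<notin> extended_centroid" using that by (simp add: qmr_of_extended_centroid)
    qed
    have "m x = 0" for x
    proof (cases "x \<in> ring_center")
      case True
      \<comment> \<open>A central \<open>x\<close> is paired with the noncentral \<open>x0\<close>,
        for which \<open>m x0 = 0\<close> is already known.\<close>
      show ?thesis
      proof (rule extended_centroid_mult_cancel[OF m])
        show "m x * qmr_of x0 \<in> extended_centroid" using mxy[of x0 x] m0[OF x0] by simp
        show "qmr_of x0 \<notin> extended_centroid" using x0 by (simp add: qmr_of_extended_centroid)
      qed
    qed (rule m0)
    then have "F x = x" for x using F[of x] by (simp add: c1 qmr_of_inject)
    then have G_star: "G x = star x" for x by (metis F_def inv(3))
    \<comment> \<open>The witness is \<open>1\<close>. It must be fixed by the extended involution,
      which follows by applying \<open>f\<close> to \<open>f 1 * 1\<close>.\<close>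
    define f where "f = ext_involution star"
    have "involution_on central_closure f"
      using ext_involution[OF assms(3)] by (simp add: f_def extends_involution_def)
    moreover have "1 \<in> central_closure" by (intro central_closure_centroid extended_centroid_one)
    ultimately have "f 1 \<in> central_closure" "f (f 1) = 1" "f (f 1 * 1) = f 1 * f (f 1)"
      unfolding involution_on_def by blast+
    then have "f 1 = 1" by simp
    then show ?thesis
      by (intro disjI2 bexI[of _ 1]) (simp_all add: G_star f_def extended_centroid_one)
  next
    case False
    have kC: "c - c * c \<in> extended_centroid" by (intro extended_centroid_closed c)
    obtain k where k: "k \<in> extended_centroid" "k * (c - c * c) = 1"
      using extended_centroid_inverse[OF kC False] by metis
    \<comment> \<open>\<open>s x\<close> is half the trace of \<open>x\<close>: dividing
      \<open>key\<close> by \<open>c - c^2\<close> and adding the scalar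
      \<open>2 (s x) (s y)\<close> completes it to the anticommutator of \<open>x - s x\<close> and
      \<open>y - s y\<close>.\<close>
    define s where "s x = k * (c * m x)" for x
    have kk: "k * ((c - c * c) * p - q) = p - k * q" for p q
    proof -
      have "k * ((c - c * c) * p) = p" by (simp only: mult.assoc[symmetric] k(2) mult_1_left)
      then show ?thesis by (simp only: right_diff_distrib[of k "(c - c * c) * p"])
    qed
    have s: "s x \<in> extended_centroid" for x unfolding s_def by (intro extended_centroid_closed k c m)
    interpret quadratic_prime_ring "\<lambda>x. qmr_of x - s x"
    proof
      show "qmr_of x - (qmr_of x - s x) \<in> extended_centroid" for x by (simp add: s)
      fix x y :: 'a
      have "(qmr_of x - s x) * (qmr_of y - s y) + (qmr_of y - s y) * (qmr_of x - s x)
        = (qmr_of x * qmr_of y + qmr_of y * qmr_of x)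
          - (s y * qmr_of x + s y * qmr_of x + (s x * qmr_of y + s x * qmr_of y)) + (s x * s y + s y * s x)"
        by (simp add: algebra_simps extended_centroid_commute[OF s, of y "qmr_of x"]
            extended_centroid_commute[OF s, of x "qmr_of y"])
      also have "(qmr_of x * qmr_of y + qmr_of y * qmr_of x)
          - (s y * qmr_of x + s y * qmr_of x + (s x * qmr_of y + s x * qmr_of y))
        = k * ((c - c * c) * (qmr_of x * qmr_of y + qmr_of y * qmr_of x)
      - (c * m y * qmr_of x + c * m y * qmr_of x + (c * m x * qmr_of y + c * m x * qmr_of y)))"
        unfolding kk by (simp add: s_def distrib_left mult.assoc)
      finally show "(qmr_of x - s x) * (qmr_of y - s y) + (qmr_of y - s y) * (qmr_of x - s x) \<in> extended_centroid"
        using key[of x y] by (auto intro!: extended_centroid_closed k s)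
    qed (rule two assms(1); assumption?)+
    show ?thesis using order_in_central_simple by blast
  qed
qed

end
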